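(* Let $(\Omega_i, \mathcal{A}_i, \mu_i)$, $i=1,\ldots,n$, be probability spaces, and denote by $(\Omega, \mathcal{A}, \mu) := \otimes_{i=1}^n (\Omega_i, \mathcal{A}_i, \mu_i)$ their product. Let $f \colon \Omega \to \mathbb{R}$ be a bounded measurable function whose Hoeffding decomposition with respect to $\mu$ is given by $f = \sum_{k=2}^{n} f_k$ (i.e. the Hoeffding terms of degrees $0$ and $1$ vanish). Assume that $$|\mathfrak{d}|\mathfrak{d} f|| \le 1 \qquad\text{and}\qquad \int \lVert \mathfrak{d}^{(2)} f \rVert_{\mathrm{HS}}^2 \, d\mu \le b^2$$ for some $b \ge 0$. Then $$\int \exp\left(\frac{1}{2(3+b^2)}|f|\right) d\mu \le 2.$$
   Context: Let $(\Omega,\mathcal A,\mu)=\otimes_{i=1}^n(\Omega_i,\mathcal A_i,\mu_i)$ be a product of probability spaces. For $f\in L^2(\mu)$ and $i=1,\ldots,n$ set $$\mathfrak{d}_i f(x) := \Big(\tfrac12\int_{\Omega_i}(f(x)-f(x_1,\ldots,x_{i-1},y_i,x_{i+1},\ldots,x_n))^2\mu_i(dy_i)\Big)^{1/2},$$ $\mathfrak{d}f:=(\mathfrak{d}_1f,\ldots,\mathfrak{d}_nf)$, and let $|\mathfrak d f|$ be its Euclidean norm, a function on $\Omega$. $|\mathfrak{d}|\mathfrak{d}f||$ is the Euclidean norm of $\mathfrak{d}$ applied to the function $|\mathfrak{d}f|$; the bound on it is pointwise. For $i\neq j$ set $$\mathfrak{d}_{ij}f(x):=\Big(\tfrac14\int_{\Omega_i}\int_{\Omega_j}\big(f(x)-f(\ldots,y_i,\ldots)-f(\ldots,y_j,\ldots)+f(\ldots,y_i,\ldots,y_j,\ldots)\big)^2\mu_i(dy_i)\mu_j(dy_j)\Big)^{1/2},$$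 where in the arguments the indicated coordinates $x_i$ and/or $x_j$ of $x$ are replaced by $y_i$ and/or $y_j$ and the other coordinates of $x$ are kept. $\mathfrak{d}^{(2)}f$ is the $n\times n$ matrix with entries $\mathfrak{d}_{ij}f$ for $i\ne j$ and $0$ on the diagonal. $\lVert A\rVert_{\mathrm{HS}}=(\sum_{i,j}|a_{ij}|^2)^{1/2}$. Hoeffding decomposition: every $f\in L^1(\mu)$ has a unique decomposition $f=f_0+f_1+\ldots+f_n$ with $f_0=\int f\,d\mu$ and $f_k(x)=\sum_{i_1<\ldots<i_k}h_{i_1\ldots i_k}(x_{i_1},\ldots,x_{i_k})$ such that $\int h_{i_1\ldots i_k}(x_{i_1},\ldots,x_{i_k})\,\mu_{i_j}(dx_{i_j})=0$ for all $k=1,\ldots,n$, all $i_1<\ldots<i_k$ and all $j\in\{1,\ldots,k\}$. $f_k$ is called the $k$-th Hoeffding term of $f$. *)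

theory Defs
  imports "HOL-Probability.Probability"
begin

text \<open>
  The product of the probability spaces \<open>M 1, \<dots>, M n\<close> is \<open>PiM {1..n} M\<close>: its points are the
  extensional functions \<open>x\<close> on \<open>{1..n}\<close>, and replacing the coordinate \<open>x\<^sub>i\<close> by \<open>y\<close> is
  \<open>x(i := y)\<close>. The factors are carried by sets in one common type \<open>'a\<close>. The integrals below are
  Bochner integrals, so the difference operators have their intended meaning only for functions
  whose squared differences are integrable in the resampled coordinates, in particular for
  bounded measurable ones.
\<close>

definition diff_op :: "(nat \<Rightarrow> 'a measure) \<Rightarrow> nat \<Rightarrow> ((nat \<Rightarrow> 'a) \<Rightarrow> real) \<Rightarrow> (nat \<Rightarrow> 'a) \<Rightarrow> real"
  where "diff_op M i f x = sqrt (1 / 2 * (\<integral>y. (f x - f (x(i := y)))\<^sup>2 \<partial>M i))"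

definition diff_norm :: "nat \<Rightarrow> (nat \<Rightarrow> 'a measure) \<Rightarrow> ((nat \<Rightarrow> 'a) \<Rightarrow> real) \<Rightarrow> (nat \<Rightarrow> 'a) \<Rightarrow> real"
  where "diff_norm n M f x = L2_set (\<lambda>i. diff_op M i f x) {1..n}"

definition diff2_op ::
    "(nat \<Rightarrow> 'a measure) \<Rightarrow> nat \<Rightarrow> nat \<Rightarrow> ((nat \<Rightarrow> 'a) \<Rightarrow> real) \<Rightarrow> (nat \<Rightarrow> 'a) \<Rightarrow> real"
  where "diff2_op M i j f x =
    sqrt (1 / 4 * (\<integral>yi. (\<integral>yj. (f x - f (x(i := yi)) - f (x(j := yj))
                                  + f (x(i := yi, j := yj)))\<^sup>2 \<partial>M j) \<partial>M i))"

definition diff2_matrix ::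
    "(nat \<Rightarrow> 'a measure) \<Rightarrow> ((nat \<Rightarrow> 'a) \<Rightarrow> real) \<Rightarrow> (nat \<Rightarrow> 'a) \<Rightarrow> nat \<Rightarrow> nat \<Rightarrow> real"
  where "diff2_matrix M f x i j = (if i = j then 0 else diff2_op M i j f x)"

definition hs_norm :: "nat \<Rightarrow> (nat \<Rightarrow> nat \<Rightarrow> real) \<Rightarrow> real"
  where "hs_norm n A = sqrt (\<Sum>i = 1..n. \<Sum>j = 1..n. \<bar>A i j\<bar>\<^sup>2)"

text \<open>
  Index tuples \<open>i\<^sub>1 < \<dots> < i\<^sub>k\<close> in \<open>{1..n}\<close> are encoded as the sets \<open>I = {i\<^sub>1, \<dots>, i\<^sub>k}\<close> of
  cardinality \<open>k\<close>, and \<open>h I\<close> is a function on the product of the factors indexed by \<open>I\<close>.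
  As usual in \<open>L\<^sup>1\<close>, identities between functions are understood almost everywhere.
  Integrability of \<open>h I\<close> has to be stated: the Bochner integral of a non-integrable function
  is \<open>0\<close>.
\<close>

definition hoeffding_kernel ::
    "(nat \<Rightarrow> 'a measure) \<Rightarrow> nat set \<Rightarrow> ((nat \<Rightarrow> 'a) \<Rightarrow> real) \<Rightarrow> bool"
  where "hoeffding_kernel M I h \<longleftrightarrow>
    integrable (PiM I M) h \<and>
    (\<forall>i\<in>I. AE x in PiM I M. (\<integral>y. h (x(i := y)) \<partial>M i) = 0)"

text \<open>\<open>F k\<close> is the \<open>k\<close>-th Hoeffding term of \<open>f\<close>; it is irrelevant for \<open>k > n\<close>.\<close>

definition hoeffding_decomposition ::
    "nat \<Rightarrow> (nat \<Rightarrow> 'a measure) \<Rightarrow> ((nat \<Rightarrow> 'a) \<Rightarrow> real) \<Rightarrow> (nat \<Rightarrow> (nat \<Rightarrow> 'a) \<Rightarrow> real) \<Rightarrow> bool"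
  where "hoeffding_decomposition n M f F \<longleftrightarrow>
    (AE x in PiM {1..n} M. f x = (\<Sum>k = 0..n. F k x)) \<and>
    (AE x in PiM {1..n} M. F 0 x = (\<integral>z. f z \<partial>PiM {1..n} M)) \<and>
    (\<forall>k\<in>{1..n}. \<exists>h.
       (\<forall>I. I \<subseteq> {1..n} \<and> card I = k \<longrightarrow> hoeffding_kernel M I (h I)) \<and>
       (AE x in PiM {1..n} M. F k x = (\<Sum>I | I \<subseteq> {1..n} \<and> card I = k. h I (restrict x I))))"

end

theory Submission
  imports Defs
begin

text \<open>
  Write \<open>\<Gamma> = \<bar>df\<bar>\<^sup>2\<close> for the sum of the \<open>(d\<^sub>i f)\<^sup>2\<close>, and \<open>g = \<bar>df\<bar>\<close>. The argument rests on the modified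
  logarithmic Sobolev inequality \<open>Ent (e\<^sup>u) \<le> \<integral>\<bar>du\<bar>\<^sup>2 e\<^sup>u d\<mu>\<close> for bounded \<open>u\<close> on a product space
  (\<open>modified_log_sobolev\<close>). It holds because entropy is subadditive over the coordinates, and
  because on a single factor the entropy is at most the covariance of \<open>u\<close> and \<open>e\<^sup>u\<close>.

  It is used twice. Since \<open>\<bar>dg\<bar> \<le> 1\<close>, the Herbst argument makes \<open>g\<close> subgaussian around its mean
  (\<open>subgaussian\<close>), and averaging over an independent Gaussian variable upgrades this to a bound for
  \<open>\<integral>exp (s g\<^sup>2) d\<mu>\<close> in terms of \<open>\<integral>g d\<mu>\<close> (\<open>exp_square_moment\<close>). For \<open>f\<close> itself, the entropy of
  \<open>e\<^bsup>tf\<^esup>\<close> is at most \<open>t\<^sup>2 \<integral>\<Gamma> e\<^bsup>tf\<^esup> d\<mu>\<close>; the duality between entropy and exponential moments bounds this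
  by the entropy again and the exponential moment of \<open>\<Gamma> = g\<^sup>2\<close> just obtained
  (\<open>exp_moment_of_gradient_moment\<close>).

  It remains to bound the mean of \<open>g\<close>, and this is where the vanishing of the Hoeffding terms of
  degree \<open>0\<close> and \<open>1\<close> comes in. It means that \<open>f\<close> is orthogonal to every function of a single
  coordinate. Hence \<open>f - \<integral>f d\<mu>\<^sub>i\<close> has conditional expectation \<open>0\<close> given \<open>x\<^sub>i\<close>, and the Efron--Stein
  inequality in the other coordinates bounds \<open>\<integral>(d\<^sub>i f)\<^sup>2 d\<mu>\<close> by the sum over \<open>j \<noteq> i\<close> of the integrals
  of \<open>(d\<^sub>i\<^sub>j f)\<^sup>2\<close> (\<open>resample_var_le_mixed_var\<close>). Summing over \<open>i\<close>,
  \<open>(\<integral>g d\<mu>)\<^sup>2 \<le> \<integral>\<Gamma> d\<mu> \<le> b\<^sup>2\<close>.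

  With suitable constants this yields \<open>\<integral>exp (T f) d\<mu> \<le> sqrt 2\<close> and \<open>\<integral>exp (- T f) d\<mu> \<le> sqrt 2\<close> for
  \<open>T = 3 / (4 (3 + b\<^sup>2))\<close>, so \<open>\<integral>exp (T \<bar>f\<bar>) d\<mu> \<le> 2\<^bsup>3/2\<^esup>\<close>, and Jensen's inequality for the power
  \<open>2/3\<close> gives the claim.
\<close>

section \<open>Bounded measurable functions\<close>

text \<open>
  On a probability space such functions are integrable, so integrability conditions reduce to
  the closure properties collected in \<open>bdd_meas_intros\<close>. Boundedness on the space suffices,
  since the functions at hand are arbitrary outside of it.
\<close>

definition bdd_meas :: "'b measure \<Rightarrow> ('b \<Rightarrow> real) \<Rightarrow> bool"
  where "bdd_meas K u \<longleftrightarrow> u \<in> borel_measurable K \<and> (\<exists>C. \<forall>x\<in>space K. \<bar>u x\<bar> \<le> C)"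

named_theorems bdd_meas_intros

lemma bdd_measI: "u \<in> borel_measurable K \<Longrightarrow> (\<And>x. x \<in> space K \<Longrightarrow> \<bar>u x\<bar> \<le> C) \<Longrightarrow> bdd_meas K u"
  unfolding bdd_meas_def by blast

lemma bdd_meas_measurable [measurable_dest]: "bdd_meas K u \<Longrightarrow> u \<in> borel_measurable K"
  unfolding bdd_meas_def by blast

lemma bdd_meas_bound:
  assumes "bdd_meas K u"
  obtains C where "C \<ge> 0" "\<And>x. x \<in> space K \<Longrightarrow> \<bar>u x\<bar> \<le> C"
proof -
  obtain C where C: "\<And>x. x \<in> space K \<Longrightarrow> \<bar>u x\<bar> \<le> C"
    using assms unfolding bdd_meas_def by blast
  show thesis by (rule that[of "max C 0"]) (auto intro: order_trans[OF C])
qed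

lemma bdd_meas_const [bdd_meas_intros]: "bdd_meas K (\<lambda>x. c)"
  by (rule bdd_measI[of _ _ "\<bar>c\<bar>"]) auto

lemma bdd_meas_add [bdd_meas_intros]:
  assumes "bdd_meas K u" "bdd_meas K v"
  shows "bdd_meas K (\<lambda>x. u x + v x)"
proof -
  obtain C where C: "\<And>x. x \<in> space K \<Longrightarrow> \<bar>u x\<bar> \<le> C" using bdd_meas_bound[OF assms(1)] by blast
  obtain D where D: "\<And>x. x \<in> space K \<Longrightarrow> \<bar>v x\<bar> \<le> D" using bdd_meas_bound[OF assms(2)] by blast
  note [measurable] = assms
  show ?thesis
    by (rule bdd_measI[of _ _ "C + D"]) (auto intro: order_trans[OF abs_triangle_ineq] add_mono C D)
qed

lemma bdd_meas_mult [bdd_meas_intros]: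
  assumes "bdd_meas K u" "bdd_meas K v"
  shows "bdd_meas K (\<lambda>x. u x * v x)"
proof -
  obtain C where C: "C \<ge> 0" "\<And>x. x \<in> space K \<Longrightarrow> \<bar>u x\<bar> \<le> C" using bdd_meas_bound[OF assms(1)] by blast
  obtain D where D: "\<And>x. x \<in> space K \<Longrightarrow> \<bar>v x\<bar> \<le> D" using bdd_meas_bound[OF assms(2)] by blast
  note [measurable] = assms
  show ?thesis
    by (rule bdd_measI[of _ _ "C * D"]) (auto simp: abs_mult intro!: mult_mono C D)
qed

lemma bdd_meas_uminus [bdd_meas_intros]: "bdd_meas K u \<Longrightarrow> bdd_meas K (\<lambda>x. - u x)"
  unfolding bdd_meas_def by auto

lemma bdd_meas_diff [bdd_meas_intros]:
  "bdd_meas K u \<Longrightarrow> bdd_meas K v \<Longrightarrow> bdd_meas K (\<lambda>x. u x - v x)"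
  using bdd_meas_add[of K u "\<lambda>x. - v x"] bdd_meas_uminus[of K v] by simp

lemma bdd_meas_divide [bdd_meas_intros]:
  fixes c :: real
  shows "bdd_meas K u \<Longrightarrow> bdd_meas K (\<lambda>x. u x / c)"
  using bdd_meas_mult[OF _ bdd_meas_const[of K "1 / c"], of u] by simp

lemma bdd_meas_abs [bdd_meas_intros]: "bdd_meas K u \<Longrightarrow> bdd_meas K (\<lambda>x. \<bar>u x\<bar>)"
  unfolding bdd_meas_def by auto

lemma bdd_meas_power [bdd_meas_intros]: "bdd_meas K u \<Longrightarrow> bdd_meas K (\<lambda>x. (u x) ^ k)"
  by (induction k) (auto intro!: bdd_meas_intros)

lemma bdd_meas_exp [bdd_meas_intros]: "bdd_meas K u \<Longrightarrow> bdd_meas K (\<lambda>x. exp (u x))"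
proof -
  assume u: "bdd_meas K u"
  obtain C where C: "\<And>x. x \<in> space K \<Longrightarrow> \<bar>u x\<bar> \<le> C" using bdd_meas_bound[OF u] by blast
  note [measurable] = u
  show ?thesis
    by (rule bdd_measI[of _ _ "exp C"]) (use C in \<open>auto simp: abs_le_iff\<close>)
qed

lemma bdd_meas_sqrt [bdd_meas_intros]: "bdd_meas K u \<Longrightarrow> bdd_meas K (\<lambda>x. sqrt (u x))"
proof -
  assume u: "bdd_meas K u"
  obtain C where C: "\<And>x. x \<in> space K \<Longrightarrow> \<bar>u x\<bar> \<le> C" using bdd_meas_bound[OF u] by blast
  note [measurable] = u
  show ?thesis
    by (rule bdd_measI[of _ _ "sqrt C"]) (use C in \<open>auto simp: real_sqrt_abs real_sqrt_abs2 simp flip: real_sqrt_abs2 intro: order_trans[OF _ real_sqrt_le_mono]\<close>)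
qed

lemma bdd_meas_sum [bdd_meas_intros]:
  "(\<And>j. j \<in> J \<Longrightarrow> bdd_meas K (u j)) \<Longrightarrow> bdd_meas K (\<lambda>x. \<Sum>j\<in>J. u j x)"
  by (induction J rule: infinite_finite_induct) (auto intro!: bdd_meas_intros)

lemma bdd_meas_compose:
  assumes "bdd_meas N u" "T \<in> measurable K N"
  shows "bdd_meas K (\<lambda>x. u (T x))"
proof -
  obtain C where C: "\<And>x. x \<in> space N \<Longrightarrow> \<bar>u x\<bar> \<le> C" using bdd_meas_bound[OF assms(1)] by blast
  show ?thesis
    by (rule bdd_measI[of _ _ C])
      (use C measurable_space[OF assms(2)] measurable_compose[OF assms(2) bdd_meas_measurable[OF assms(1)]] in auto)
qed

lemma bdd_meas_fst [bdd_meas_intros]: "bdd_meas K u \<Longrightarrow> bdd_meas (K \<Otimes>\<^sub>M L) (\<lambda>p. u (fst p))"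
  by (erule bdd_meas_compose) simp

lemma bdd_meas_snd [bdd_meas_intros]: "bdd_meas L u \<Longrightarrow> bdd_meas (K \<Otimes>\<^sub>M L) (\<lambda>p. u (snd p))"
  by (erule bdd_meas_compose) simp

lemma (in finite_measure) integrable_bdd_meas: "bdd_meas M u \<Longrightarrow> integrable M u"
  by (metis AE_I2 bdd_meas_def integrable_const_bound real_norm_def)

lemma (in prob_space) abs_integral_le:
  assumes "bdd_meas M u" "\<And>x. x \<in> space M \<Longrightarrow> \<bar>u x\<bar> \<le> C"
  shows "\<bar>\<integral>x. u x \<partial>M\<bar> \<le> C"
proof -
  have "\<bar>\<integral>x. u x \<partial>M\<bar> \<le> (\<integral>x. \<bar>u x\<bar> \<partial>M)" by (rule integral_abs_bound)
  also have "\<dots> \<le> (\<integral>x. C \<partial>M)"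
    by (rule integral_mono) (use assms in \<open>auto intro!: integrable_bdd_meas bdd_meas_intros\<close>)
  finally show ?thesis by (simp add: prob_space)
qed

lemma (in prob_space) bdd_meas_integral:
  assumes "bdd_meas (K \<Otimes>\<^sub>M M) (\<lambda>p. \<Phi> (fst p) (snd p))"
  shows "bdd_meas K (\<lambda>x. \<integral>y. \<Phi> x y \<partial>M)"
proof -
  obtain C where C: "\<And>p. p \<in> space (K \<Otimes>\<^sub>M M) \<Longrightarrow> \<bar>\<Phi> (fst p) (snd p)\<bar> \<le> C"
    using bdd_meas_bound[OF assms] by blast
  have [measurable]: "(\<lambda>p. \<Phi> (fst p) (snd p)) \<in> borel_measurable (K \<Otimes>\<^sub>M M)"
    using assms by (rule bdd_meas_measurable)
  show ?thesis
  proof (rule bdd_measI[of _ _ C])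
    show "(\<lambda>x. \<integral>y. \<Phi> x y \<partial>M) \<in> borel_measurable K" 
      by (intro borel_measurable_lebesgue_integral) (simp add: case_prod_beta')
    fix x assume x: "x \<in> space K"
    have "bdd_meas M (\<lambda>y. \<Phi> x y)"
      using bdd_meas_compose[OF assms measurable_Pair1'[OF x]] by simp
    then show "\<bar>\<integral>y. \<Phi> x y \<partial>M\<bar> \<le> C"
      by (rule abs_integral_le) (use C[of "(x, _)"] x in \<open>auto simp: space_pair_measure\<close>)
  qed
qed

lemma (in prob_space) integral_swap:
  assumes L: "prob_space L" and b: "bdd_meas (L \<Otimes>\<^sub>M M) (\<lambda>p. D (fst p) (snd p))"
  shows "(\<integral>x. \<integral>y. D x y \<partial>M \<partial>L) = (\<integral>y. \<integral>x. D x y \<partial>L \<partial>M)"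
proof -
  interpret L: prob_space L by fact
  interpret pair_prob_space L M ..
  show ?thesis
    by (rule Fubini_integral[symmetric]) (use P.integrable_bdd_meas[OF b] in \<open>simp add: case_prod_beta'\<close>)
qed

lemma (in prob_space) integral_exp_pos:
  assumes "bdd_meas M u"
  shows "0 < (\<integral>x. exp (u x) \<partial>M)"
proof -
  obtain C where C: "\<And>x. x \<in> space M \<Longrightarrow> \<bar>u x\<bar> \<le> C" using bdd_meas_bound[OF assms] by blast
  have "exp (-C) = (\<integral>x. exp (-C) \<partial>M)" by (simp add: prob_space)
  also have "\<dots> \<le> (\<integral>x. exp (u x) \<partial>M)"
    by (rule integral_mono) (use C in \<open>auto intro!: integrable_bdd_meas bdd_meas_intros assms simp: abs_le_iff minus_le_iff\<close>)
  finally show ?thesis using exp_gt_zero[of "-C"] by linarith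
qed

section \<open>Entropy and its variational formulas\<close>

text \<open>
  The entropy functional at the density \<open>e\<^sup>u\<close>. Parametrising densities by their logarithm keeps
  them bounded away from \<open>0\<close>.
\<close>

definition exp_entropy :: "'b measure \<Rightarrow> ('b \<Rightarrow> real) \<Rightarrow> real"
  where "exp_entropy K u = (\<integral>x. exp (u x) * u x \<partial>K) - (\<integral>x. exp (u x) \<partial>K) * ln (\<integral>x. exp (u x) \<partial>K)"

text \<open>
  Among all densities with the same mass, \<open>e\<^sup>u\<close> itself maximises the pairing of \<open>e\<^sup>u\<close> with
  a log-density. The proof integrates \<open>e\<^sup>u (1 + (q - u)) \<le> e\<^sup>q\<close>. Both the duality formula and the
  tensorization of entropy are instances of this inequality.
\<close>

lemma (in prob_space) gibbs_inequality:
  assumes u: "bdd_meas M u" and q: "bdd_meas M q"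
    and le: "(\<integral>x. exp (q x) \<partial>M) \<le> (\<integral>x. exp (u x) \<partial>M)"
  shows "(\<integral>x. exp (u x) * q x \<partial>M) \<le> (\<integral>x. exp (u x) * u x \<partial>M)"
proof -
  have "(\<integral>x. exp (u x) * q x \<partial>M) - (\<integral>x. exp (u x) * u x \<partial>M) = (\<integral>x. exp (u x) * q x - exp (u x) * u x \<partial>M)"
    by (subst Bochner_Integration.integral_diff) (auto intro!: integrable_bdd_meas bdd_meas_intros u q)
  also have "\<dots> \<le> (\<integral>x. exp (q x) - exp (u x) \<partial>M)"
  proof (rule integral_mono)
    fix x
    have "exp (u x) * (1 + (q x - u x)) \<le> exp (u x) * exp (q x - u x)"
      by (intro mult_left_mono exp_ge_add_one_self) auto
    then show "exp (u x) * q x - exp (u x) * u x \<le> exp (q x) - exp (u x)"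
      by (simp add: exp_diff algebra_simps)
  qed (auto intro!: integrable_bdd_meas bdd_meas_intros u q)
  also have "\<dots> = (\<integral>x. exp (q x) \<partial>M) - (\<integral>x. exp (u x) \<partial>M)"
    by (rule Bochner_Integration.integral_diff) (auto intro!: integrable_bdd_meas bdd_meas_intros u q)
  finally show ?thesis using le by simp
qed

text \<open>
  Apply the Gibbs inequality to \<open>G\<close>, shifted by the constant that gives \<open>e\<^sup>G\<close> the mass of \<open>e\<^sup>u\<close>.
  This trades a tilted expectation of \<open>G\<close> for an exponential moment of \<open>G\<close> under the original measure.
\<close>

lemma (in prob_space) entropy_duality:
  assumes u: "bdd_meas M u" and G: "bdd_meas M G"
  shows "(\<integral>x. exp (u x) * G x \<partial>M) \<le>
    exp_entropy M u + (\<integral>x. exp (u x) \<partial>M) * ln (\<integral>x. exp (G x) \<partial>M)"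
proof -
  let ?Z = "\<integral>x. exp (u x) \<partial>M" and ?W = "\<integral>x. exp (G x) \<partial>M"
  have Z: "?Z > 0" and W: "?W > 0" using integral_exp_pos u G by auto
  have "(\<integral>x. exp (u x) * (G x + (ln ?Z - ln ?W)) \<partial>M) \<le> (\<integral>x. exp (u x) * u x \<partial>M)"
  proof (rule gibbs_inequality)
    have "(\<integral>x. exp (G x + (ln ?Z - ln ?W)) \<partial>M) = ?W * (?Z / ?W)"
      using Z W by (simp add: exp_add exp_diff)
    then show "(\<integral>x. exp (G x + (ln ?Z - ln ?W)) \<partial>M) \<le> ?Z" using W by simp
  qed (auto intro!: bdd_meas_intros u G)
  also have "(\<integral>x. exp (u x) * (G x + (ln ?Z - ln ?W)) \<partial>M)
      = (\<integral>x. exp (u x) * G x \<partial>M) + ?Z * (ln ?Z - ln ?W)"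
    unfolding distrib_left
    by (subst Bochner_Integration.integral_add) (auto intro!: integrable_bdd_meas bdd_meas_intros u G)
  finally show ?thesis by (simp add: exp_entropy_def algebra_simps)
qed

text \<open>
  Up to a factor this is \<open>tanh (d/2) \<le> d/2\<close> for \<open>d = a - b \<ge> 0\<close>, in the form
  \<open>(d - 2) e\<^sup>d + d + 2 \<ge> 0\<close>: the left hand side vanishes at \<open>0\<close> and has the derivative
  \<open>(d - 1) e\<^sup>d + 1 \<ge> 0\<close>.
\<close>

lemma exp_diff_mult_le:
  fixes a b :: real
  shows "(exp a - exp b) * (a - b) \<le> 1 / 2 * (exp a + exp b) * (a - b)\<^sup>2"
proof -
  have *: "(exp a - exp b) * (a - b) \<le> 1 / 2 * (exp a + exp b) * (a - b)\<^sup>2" if "b \<le> a" for a b :: real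
  proof -
    let ?h = "\<lambda>d::real. (d - 2) * exp d + d + 2"
    have "?h 0 \<le> ?h (a - b)"
    proof (rule DERIV_nonneg_imp_nondecreasing[of 0 "a - b" ?h])
      fix x :: real assume "0 \<le> x" "x \<le> a - b"
      have "exp (-x) \<ge> 1 - x" using exp_ge_add_one_self[of "-x"] by simp
      then have "exp x * (1 - x) \<le> exp x * exp (-x)" by (intro mult_left_mono) auto
      then have "(x - 1) * exp x + 1 \<ge> 0" by (simp add: exp_minus algebra_simps)
      moreover have "(?h has_real_derivative (x - 1) * exp x + 1) (at x)"
        by (auto intro!: derivative_eq_intros simp: algebra_simps)
      ultimately show "\<exists>y. (?h has_real_derivative y) (at x) \<and> 0 \<le> y" by blast
    qed (use that in auto)
    then have h: "0 \<le> ?h (a - b)" by simp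
    have "0 \<le> exp b * ?h (a - b) * (a - b)" using h that by (intro mult_nonneg_nonneg) auto
    also have "exp b * ?h (a - b) = (a - b - 2) * (exp b * exp (a - b)) + (a - b + 2) * exp b"
      by (simp add: algebra_simps)
    also have "exp b * exp (a - b) = exp a"
      by (simp flip: exp_add)
    finally show ?thesis by (simp add: power2_eq_square algebra_simps add_divide_distrib)
  qed
  show ?thesis
  proof (cases "b \<le> a")
    case False
    then show ?thesis using *[of a b] by (simp add: power2_commute[of a b] algebra_simps)
  qed (rule *)
qed

text \<open>
  One factor of the modified logarithmic Sobolev inequality. By Jensen, the entropy is at most the
  covariance of \<open>\<phi>\<close> and \<open>e\<^sup>\<phi>\<close>. Written as a double integral, both this covariance and the right
  hand side may be symmetrised in the two variables, and then the bound holds pointwise.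
\<close>

lemma (in prob_space) exp_entropy_le_gradient:
  assumes \<phi>: "bdd_meas M \<phi>"
  shows "exp_entropy M \<phi> \<le> (\<integral>x. exp (\<phi> x) * (1 / 2 * (\<integral>y. (\<phi> x - \<phi> y)\<^sup>2 \<partial>M)) \<partial>M)"
proof -
  note bm = integrable_bdd_meas bdd_meas_intros \<phi>
  \<comment> \<open>covariance integrand minus gradient integrand; its symmetrisation is nonpositive\<close>
  let ?D = "\<lambda>x y. exp (\<phi> x) * (\<phi> x - \<phi> y) - exp (\<phi> x) * (1 / 2 * (\<phi> x - \<phi> y)\<^sup>2)"
  have bD: "bdd_meas (M \<Otimes>\<^sub>M M) (\<lambda>p. ?D (fst p) (snd p))" "bdd_meas (M \<Otimes>\<^sub>M M) (\<lambda>p. ?D (snd p) (fst p))"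
    by (intro bm)+
  have "2 * (\<integral>x. \<integral>y. ?D x y \<partial>M \<partial>M) = (\<integral>x. \<integral>y. ?D x y \<partial>M \<partial>M) + (\<integral>x. \<integral>y. ?D y x \<partial>M \<partial>M)"
    using integral_swap[OF prob_space_axioms bD(1)] by simp
  also have "\<dots> = (\<integral>x. (\<integral>y. ?D x y \<partial>M) + (\<integral>y. ?D y x \<partial>M) \<partial>M)"
    by (rule Bochner_Integration.integral_add[symmetric]; intro integrable_bdd_meas bdd_meas_integral bD)
  also have "\<dots> = (\<integral>x. (\<integral>y. ?D x y + ?D y x \<partial>M) \<partial>M)"
    by (intro Bochner_Integration.integral_cong refl Bochner_Integration.integral_add[symmetric] bm)
  also have "\<dots> \<le> (\<integral>x. (\<integral>y. 0 \<partial>M) \<partial>M)"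
  proof (intro integral_mono)
    show "?D x y + ?D y x \<le> 0" for x y
      using exp_diff_mult_le[of "\<phi> x" "\<phi> y"] by (simp add: power2_eq_square algebra_simps add_divide_distrib)
  qed (intro integrable_bdd_meas bdd_meas_integral bdd_meas_add bD bm)+
  finally have D: "(\<integral>x. \<integral>y. ?D x y \<partial>M \<partial>M) \<le> 0" by simp
  have inner: "(\<integral>y. ?D x y \<partial>M) = exp (\<phi> x) * (\<phi> x - (\<integral>y. \<phi> y \<partial>M))
      - exp (\<phi> x) * (1 / 2 * (\<integral>y. (\<phi> x - \<phi> y)\<^sup>2 \<partial>M))" for x
  proof -
    have "(\<integral>y. ?D x y \<partial>M) = (\<integral>y. exp (\<phi> x) * (\<phi> x - \<phi> y) \<partial>M) - (\<integral>y. exp (\<phi> x) * (1 / 2 * (\<phi> x - \<phi> y)\<^sup>2) \<partial>M)"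
      by (rule Bochner_Integration.integral_diff; intro bm)
    moreover have "(\<integral>y. \<phi> x - \<phi> y \<partial>M) = \<phi> x - (\<integral>y. \<phi> y \<partial>M)"
      by (subst Bochner_Integration.integral_diff) (auto intro!: bm simp: prob_space)
    ultimately show ?thesis by simp
  qed
  have bint: "bdd_meas M (\<lambda>x. exp (\<phi> x) * (1 / 2 * (\<integral>y. (\<phi> x - \<phi> y)\<^sup>2 \<partial>M)))"
    by (intro bm bdd_meas_integral)
  have "(\<integral>x. \<integral>y. ?D x y \<partial>M \<partial>M) = (\<integral>x. exp (\<phi> x) * (\<phi> x - (\<integral>y. \<phi> y \<partial>M)) \<partial>M)
      - (\<integral>x. exp (\<phi> x) * (1 / 2 * (\<integral>y. (\<phi> x - \<phi> y)\<^sup>2 \<partial>M)) \<partial>M)"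
    unfolding inner by (rule Bochner_Integration.integral_diff; intro bm bint)
  also have "(\<integral>x. exp (\<phi> x) * (\<phi> x - (\<integral>y. \<phi> y \<partial>M)) \<partial>M)
      = (\<integral>x. exp (\<phi> x) * \<phi> x \<partial>M) - (\<integral>x. exp (\<phi> x) \<partial>M) * (\<integral>y. \<phi> y \<partial>M)"
    unfolding right_diff_distrib by (subst Bochner_Integration.integral_diff) (auto intro!: bm)
  finally have *: "(\<integral>x. exp (\<phi> x) * \<phi> x \<partial>M) - (\<integral>x. exp (\<phi> x) \<partial>M) * (\<integral>y. \<phi> y \<partial>M)
      \<le> (\<integral>x. exp (\<phi> x) * (1 / 2 * (\<integral>y. (\<phi> x - \<phi> y)\<^sup>2 \<partial>M)) \<partial>M)"
    using D by simp
  \<comment> \<open>Jensen, as the duality formula at the trivial density\<close>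
  have "(\<integral>y. \<phi> y \<partial>M) \<le> ln (\<integral>x. exp (\<phi> x) \<partial>M)"
    using entropy_duality[OF bdd_meas_const[of M 0] \<phi>] by (simp add: exp_entropy_def prob_space)
  then have "(\<integral>x. exp (\<phi> x) \<partial>M) * (\<integral>y. \<phi> y \<partial>M) \<le> (\<integral>x. exp (\<phi> x) \<partial>M) * ln (\<integral>x. exp (\<phi> x) \<partial>M)"
    by (intro mult_left_mono) (auto intro: integral_exp_pos[OF \<phi>, THEN less_imp_le])
  then show ?thesis using * by (simp add: exp_entropy_def)
qed

section \<open>From entropy bounds to exponential moments\<close>

lemma abs_exp_taylor_le:
  fixes a b :: real
  shows "\<bar>exp a - exp b - (a - b) * exp b\<bar> \<le> (a - b)\<^sup>2 * exp (max a b)"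
proof -
  have tangent: "(x - y) * exp y \<le> exp x - exp y" for x y :: real
  proof -
    have "exp y * (1 + (x - y)) \<le> exp y * exp (x - y)"
      by (intro mult_left_mono exp_ge_add_one_self) auto
    then show ?thesis by (simp add: exp_diff algebra_simps)
  qed
  have lip: "\<bar>exp a - exp b\<bar> \<le> \<bar>a - b\<bar> * exp (max a b)"
    using tangent[of a b] tangent[of b a] by (cases "a \<le> b") (auto simp: max_def algebra_simps)
  have "exp a - exp b - (a - b) * exp b \<le> (a - b) * (exp a - exp b)"
    using tangent[of b a] by (simp add: algebra_simps)
  also have "\<dots> \<le> \<bar>a - b\<bar> * \<bar>exp a - exp b\<bar>" by (metis abs_ge_self abs_mult)
  also have "\<dots> \<le> \<bar>a - b\<bar> * (\<bar>a - b\<bar> * exp (max a b))" by (intro mult_left_mono lip) auto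
  also have "\<dots> = (a - b)\<^sup>2 * exp (max a b)" by (simp add: power2_eq_square abs_mult_self_eq mult.assoc[symmetric])
  finally show ?thesis using tangent[of a b] by simp
qed

lemma (in prob_space) DERIV_exp_moment:
  assumes f: "bdd_meas M f"
  shows "((\<lambda>t. \<integral>x. exp (t * f x) \<partial>M) has_real_derivative (\<integral>x. exp (t * f x) * f x \<partial>M)) (at t)"
proof -
  obtain C where C: "C \<ge> 0" "\<And>x. x \<in> space M \<Longrightarrow> \<bar>f x\<bar> \<le> C" using bdd_meas_bound[OF f] by blast
  note bm = integrable_bdd_meas bdd_meas_intros f
  let ?\<Phi> = "\<lambda>t. \<integral>x. exp (t * f x) \<partial>M" and ?\<Psi> = "\<integral>x. exp (t * f x) * f x \<partial>M"
  let ?K = "C\<^sup>2 * exp ((\<bar>t\<bar> + 1) * C)"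
  have bound: "\<bar>(?\<Phi> (t + h) - ?\<Phi> t) / h - ?\<Psi>\<bar> \<le> ?K * \<bar>h\<bar>" if h: "h \<noteq> 0" "\<bar>h\<bar> < 1" for h
  proof -
    let ?r = "\<lambda>x. exp ((t + h) * f x) - exp (t * f x) - ((t + h) * f x - t * f x) * exp (t * f x)"
    have "(\<integral>x. ?r x \<partial>M) = ?\<Phi> (t + h) - ?\<Phi> t - (\<integral>x. ((t + h) * f x - t * f x) * exp (t * f x) \<partial>M)"
      by (subst Bochner_Integration.integral_diff, (intro bm)+, subst Bochner_Integration.integral_diff, (intro bm)+) simp
    also have "(\<integral>x. ((t + h) * f x - t * f x) * exp (t * f x) \<partial>M) = (\<integral>x. h * (exp (t * f x) * f x) \<partial>M)"
      by (intro Bochner_Integration.integral_cong) (auto simp: algebra_simps)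
    finally have r: "(\<integral>x. ?r x \<partial>M) = ?\<Phi> (t + h) - ?\<Phi> t - h * ?\<Psi>" by simp
    have "\<bar>\<integral>x. ?r x \<partial>M\<bar> \<le> ?K * h\<^sup>2"
    proof (rule abs_integral_le)
      fix x assume x: "x \<in> space M"
      have "\<bar>?r x\<bar> \<le> ((t + h) * f x - t * f x)\<^sup>2 * exp (max ((t + h) * f x) (t * f x))"
        by (rule abs_exp_taylor_le)
      also have "\<dots> \<le> (h\<^sup>2 * C\<^sup>2) * exp ((\<bar>t\<bar> + 1) * C)"
      proof (intro mult_mono)
        have "((t + h) * f x - t * f x)\<^sup>2 = h\<^sup>2 * (f x)\<^sup>2" by (simp add: algebra_simps power_mult_distrib)
        also have "(f x)\<^sup>2 \<le> C\<^sup>2" using C(2)[OF x] by (simp add: abs_le_square_iff[symmetric] C)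
        finally show "((t + h) * f x - t * f x)\<^sup>2 \<le> h\<^sup>2 * C\<^sup>2" by (simp add: mult_left_mono)
        have "s * f x \<le> (\<bar>t\<bar> + 1) * C" if "\<bar>s\<bar> \<le> \<bar>t\<bar> + 1" for s
        proof -
          have "s * f x \<le> \<bar>s\<bar> * \<bar>f x\<bar>" by (metis abs_ge_self abs_mult)
          also have "\<dots> \<le> (\<bar>t\<bar> + 1) * C" using that C(1) C(2)[OF x] by (intro mult_mono) auto
          finally show ?thesis .
        qed
        then show "exp (max ((t + h) * f x) (t * f x)) \<le> exp ((\<bar>t\<bar> + 1) * C)" using h by auto
      qed auto
      finally show "\<bar>?r x\<bar> \<le> ?K * h\<^sup>2" by (simp add: mult_ac)
    qed (intro bm)
    then have "\<bar>(?\<Phi> (t + h) - ?\<Phi> t - h * ?\<Psi>) / h\<bar> \<le> ?K * h\<^sup>2 / \<bar>h\<bar>"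
      unfolding r abs_divide by (intro divide_right_mono) auto
    then show ?thesis using h by (simp add: diff_divide_distrib power2_eq_square abs_if split: if_splits)
  qed
  have "((\<lambda>h. (?\<Phi> (t + h) - ?\<Phi> t) / h - ?\<Psi>) \<longlongrightarrow> 0) (at 0)"
  proof (rule Lim_null_comparison)
    show "\<forall>\<^sub>F h in at 0. norm ((?\<Phi> (t + h) - ?\<Phi> t) / h - ?\<Psi>) \<le> ?K * \<bar>h\<bar>"
      unfolding eventually_at by (rule exI[of _ 1]) (use bound in auto)
    show "((\<lambda>h. ?K * \<bar>h\<bar>) \<longlongrightarrow> 0) (at 0)" by (auto intro!: tendsto_eq_intros)
  qed
  then show ?thesis unfolding DERIV_def by (simp add: LIM_zero_iff)
qed

text \<open>
  The Herbst argument: with \<open>L t\<close> the logarithm of the moment generating function, the entropy of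
  \<open>e\<^bsup>tf\<^esup>\<close> is \<open>(t L' t - L t) e\<^bsup>L t\<^esup>\<close>. The hypothesis thus says that the derivative of \<open>L t / t\<close>
  is at most \<open>\<kappa>\<close>, and \<open>L t / t\<close> tends to the mean of \<open>f\<close> as \<open>t\<close> tends to \<open>0\<close>.
\<close>

lemma (in prob_space) herbst:
  assumes f: "bdd_meas M f" and T: "T > 0"
    and ent: "\<And>t. 0 < t \<Longrightarrow> t \<le> T \<Longrightarrow> exp_entropy M (\<lambda>x. t * f x) \<le> \<kappa> * t\<^sup>2 * (\<integral>x. exp (t * f x) \<partial>M)"
  shows "ln (\<integral>x. exp (T * f x) \<partial>M) \<le> T * (\<integral>x. f x \<partial>M) + \<kappa> * T\<^sup>2"
proof -
  define \<Phi> where "\<Phi> = (\<lambda>t. \<integral>x. exp (t * f x) \<partial>M)"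
  define \<Psi> where "\<Psi> = (\<lambda>t. \<integral>x. exp (t * f x) * f x \<partial>M)"
  \<comment> \<open>nonincreasing by the entropy bound\<close>
  define q where "q = (\<lambda>t. ln (\<Phi> t) / t - \<kappa> * t)"
  have pos: "\<Phi> t > 0" for t unfolding \<Phi>_def by (intro integral_exp_pos bdd_meas_intros f)
  have d\<Phi>: "(\<Phi> has_real_derivative \<Psi> t) (at t)" for t
    using DERIV_exp_moment[OF f, of t] by (simp add: \<Phi>_def \<Psi>_def)
  have dL: "((\<lambda>t. ln (\<Phi> t)) has_real_derivative \<Psi> t / \<Phi> t) (at t)" for t
    using pos by (auto intro!: derivative_eq_intros d\<Phi>)
  have dq: "(q has_real_derivative (\<Psi> t / \<Phi> t * t - ln (\<Phi> t)) / t\<^sup>2 - \<kappa>) (at t)" if "t > 0" for t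
    unfolding q_def using DERIV_diff[OF DERIV_divide[OF dL DERIV_ident] DERIV_cmult[OF DERIV_ident]] that
    by (simp add: power2_eq_square)
  have "q T \<le> q s" if s: "0 < s" "s < T" for s
  proof (rule DERIV_nonpos_imp_nonincreasing[of s T q])
    fix t assume "s \<le> t" "t \<le> T"
    then have t: "0 < t" "t \<le> T" using s by auto
    have "exp_entropy M (\<lambda>x. t * f x) = t * \<Psi> t - \<Phi> t * ln (\<Phi> t)"
      by (simp add: exp_entropy_def \<Phi>_def \<Psi>_def mult.left_commute)
    then have "t * \<Psi> t - \<Phi> t * ln (\<Phi> t) \<le> \<kappa> * t\<^sup>2 * \<Phi> t" using ent[OF t] by (simp add: \<Phi>_def)
    then have "(t * \<Psi> t - \<Phi> t * ln (\<Phi> t)) / \<Phi> t \<le> \<kappa> * t\<^sup>2" using pos by (simp add: pos_divide_le_eq)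
    then have "\<Psi> t / \<Phi> t * t - ln (\<Phi> t) \<le> \<kappa> * t\<^sup>2" using pos[of t] by (simp add: diff_divide_distrib mult.commute)
    then have "(\<Psi> t / \<Phi> t * t - ln (\<Phi> t)) / t\<^sup>2 - \<kappa> \<le> 0" using t by (simp add: pos_divide_le_eq)
    then show "\<exists>y. (q has_real_derivative y) (at t) \<and> y \<le> 0" using dq[OF t(1)] by blast
  qed (use s in auto)
  then have ev: "\<forall>\<^sub>F s in at_right 0. q T \<le> q s"
    using T unfolding eventually_at_right_field by blast
  have "\<Phi> 0 = 1" "\<Psi> 0 = (\<integral>x. f x \<partial>M)" by (auto simp: \<Phi>_def \<Psi>_def prob_space)
  then have "((\<lambda>s. ln (\<Phi> s) / s) \<longlongrightarrow> (\<integral>x. f x \<partial>M)) (at 0)"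
    using dL[of 0] unfolding DERIV_def by simp
  then have "((\<lambda>s. ln (\<Phi> s) / s) \<longlongrightarrow> (\<integral>x. f x \<partial>M)) (at_right 0)"
    by (rule tendsto_within_subset) auto
  then have "(q \<longlongrightarrow> (\<integral>x. f x \<partial>M) - \<kappa> * 0) (at_right 0)"
    unfolding q_def by (intro tendsto_intros)
  then have "q T \<le> (\<integral>x. f x \<partial>M)"
    using tendsto_lowerbound[OF _ ev] by simp
  then have "ln (\<Phi> T) / T \<le> (\<integral>x. f x \<partial>M) + \<kappa> * T" by (simp add: q_def)
  then show ?thesis using T by (simp add: \<Phi>_def pos_divide_le_eq power2_eq_square algebra_simps)
qed

lemma nn_integral_normal_density:
  assumes "\<sigma> > 0"
  shows "(\<integral>\<^sup>+ x. ennreal (normal_density m \<sigma> x) \<partial>lborel) = 1"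
  by (subst nn_integral_eq_integral) (auto simp: integral_normal_density[OF assms] integrable_normal_density[OF assms])

text \<open>
  Completing the square turns the tilted standard normal density into a multiple of the normal
  density with variance \<open>\<sigma>\<^sup>2\<close>; for \<open>s = 0\<close> this is the Gaussian moment generating function.
\<close>

lemma gaussian_complete_square:
  assumes s: "s < 1 / 4" and \<sigma>: "\<sigma> = 1 / sqrt (1 - 4 * s)"
  shows "exp (a * \<xi> + 2 * s * \<xi>\<^sup>2) * std_normal_density \<xi> = \<sigma> * exp (a\<^sup>2 * \<sigma>\<^sup>2 / 2) * normal_density (a * \<sigma>\<^sup>2) \<sigma> \<xi>"
proof -
  have s2: "\<sigma>\<^sup>2 = 1 / (1 - 4 * s)" using s by (simp add: \<sigma> power_divide)
  have pos: "\<sigma> > 0" using s by (simp add: \<sigma>)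
  have "a\<^sup>2 * \<sigma>\<^sup>2 / 2 + - (\<xi> - a * \<sigma>\<^sup>2)\<^sup>2 / (2 * \<sigma>\<^sup>2) = a * \<xi> - \<xi>\<^sup>2 / (2 * \<sigma>\<^sup>2)"
    using pos by (simp add: field_simps power2_eq_square)
  also have "\<xi>\<^sup>2 / (2 * \<sigma>\<^sup>2) = \<xi>\<^sup>2 * (1 - 4 * s) / 2" using s by (simp add: s2)
  finally have e: "a\<^sup>2 * \<sigma>\<^sup>2 / 2 + - (\<xi> - a * \<sigma>\<^sup>2)\<^sup>2 / (2 * \<sigma>\<^sup>2) = (a * \<xi> + 2 * s * \<xi>\<^sup>2) + - \<xi>\<^sup>2 / 2"
    by (simp add: field_simps)
  have "sqrt (2 * pi * \<sigma>\<^sup>2) = \<sigma> * sqrt (2 * pi)" using pos by (simp add: real_sqrt_mult)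
  then show ?thesis using pos
    unfolding normal_density_def std_normal_density_def
    by (simp add: exp_add[symmetric]) (use e in \<open>simp add: algebra_simps\<close>)
qed

text \<open>
  A square in the exponent is linearised by an independent standard Gaussian variable \<open>\<xi>\<close>:
  \<open>exp (s z\<^sup>2)\<close> is the expectation of \<open>exp (sqrt (2 s) \<xi> z)\<close>. By Tonelli the hypothesis on the
  linear exponents applies for each value of \<open>\<xi>\<close>, and a Gaussian integral is left.
\<close>

lemma (in prob_space) exp_square_moment:
  assumes g: "bdd_meas M g" and s: "0 \<le> s" "s < 1 / 4"
    and sub: "\<And>t. (\<integral>x. exp (t * g x) \<partial>M) \<le> exp (t * m + t\<^sup>2)"
  shows "(\<integral>x. exp (s * (g x)\<^sup>2) \<partial>M) \<le> 1 / sqrt (1 - 4 * s) * exp (s * m\<^sup>2 / (1 - 4 * s))"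
proof -
  define \<sigma> where "\<sigma> = 1 / sqrt (1 - 4 * s)"
  define r where "r = sqrt (2 * s)"
  have r2: "r\<^sup>2 = 2 * s" using s by (simp add: r_def)
  have pos: "\<sigma> > 0" using s by (simp add: \<sigma>_def)
  have s2: "\<sigma>\<^sup>2 = 1 / (1 - 4 * s)" using s by (simp add: \<sigma>_def power_divide)
  have [measurable]: "g \<in> borel_measurable M" by (rule bdd_meas_measurable[OF g])
  have gauss: "ennreal (exp (s * z\<^sup>2)) = (\<integral>\<^sup>+ \<xi>. ennreal (exp (r * \<xi> * z) * std_normal_density \<xi>) \<partial>lborel)" for z
  proof -
    have "(\<integral>\<^sup>+ \<xi>. ennreal (exp (r * \<xi> * z) * std_normal_density \<xi>) \<partial>lborel)
      = (\<integral>\<^sup>+ \<xi>. ennreal (exp ((r * z)\<^sup>2 / 2)) * ennreal (normal_density (r * z) 1 \<xi>) \<partial>lborel)"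
      using gaussian_complete_square[of 0 1 "r * z"]
      by (intro nn_integral_cong) (simp add: ennreal_mult'[symmetric] mult_ac)
    also have "\<dots> = ennreal (exp ((r * z)\<^sup>2 / 2))"
      by (subst nn_integral_cmult) (auto simp: nn_integral_normal_density)
    finally show ?thesis by (simp add: power_mult_distrib r2)
  qed
  interpret pair_sigma_finite M lborel ..
  have "ennreal (\<integral>x. exp (s * (g x)\<^sup>2) \<partial>M) = (\<integral>\<^sup>+ x. ennreal (exp (s * (g x)\<^sup>2)) \<partial>M)"
    by (rule nn_integral_eq_integral[symmetric]) (auto intro!: integrable_bdd_meas bdd_meas_intros g)
  also have "\<dots> = (\<integral>\<^sup>+ x. \<integral>\<^sup>+ \<xi>. ennreal (exp (r * \<xi> * g x) * std_normal_density \<xi>) \<partial>lborel \<partial>M)"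
    by (simp only: gauss)
  also have "\<dots> = (\<integral>\<^sup>+ \<xi>. \<integral>\<^sup>+ x. ennreal (exp (r * \<xi> * g x) * std_normal_density \<xi>) \<partial>M \<partial>lborel)"
    by (rule Fubini'[symmetric]) measurable
  also have "\<dots> \<le> (\<integral>\<^sup>+ \<xi>. ennreal (\<sigma> * exp ((r * m)\<^sup>2 * \<sigma>\<^sup>2 / 2)) * ennreal (normal_density (r * m * \<sigma>\<^sup>2) \<sigma> \<xi>) \<partial>lborel)"
  proof (rule nn_integral_mono)
    fix \<xi> :: real
    have "(\<integral>\<^sup>+ x. ennreal (exp (r * \<xi> * g x) * std_normal_density \<xi>) \<partial>M) = 
        (\<integral>\<^sup>+ x. ennreal (exp (r * \<xi> * g x)) \<partial>M) * ennreal (std_normal_density \<xi>)"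
      by (subst nn_integral_multc[symmetric]) (auto simp: ennreal_mult')
    also have "(\<integral>\<^sup>+ x. ennreal (exp (r * \<xi> * g x)) \<partial>M) = ennreal (\<integral>x. exp (r * \<xi> * g x) \<partial>M)"
      by (rule nn_integral_eq_integral) (auto intro!: integrable_bdd_meas bdd_meas_intros g)
    also have "\<dots> \<le> ennreal (exp (r * \<xi> * m + (r * \<xi>)\<^sup>2))" by (intro ennreal_leI sub)
    finally have "(\<integral>\<^sup>+ x. ennreal (exp (r * \<xi> * g x) * std_normal_density \<xi>) \<partial>M)
        \<le> ennreal (exp (r * m * \<xi> + 2 * s * \<xi>\<^sup>2) * std_normal_density \<xi>)"
      by (simp add: mult_right_mono ennreal_mult' power_mult_distrib r2 mult_ac)
    also have "\<dots> = ennreal (\<sigma> * exp ((r * m)\<^sup>2 * \<sigma>\<^sup>2 / 2)) * ennreal (normal_density (r * m * \<sigma>\<^sup>2) \<sigma> \<xi>)"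
      using pos by (subst gaussian_complete_square[OF s(2) \<sigma>_def]) (simp add: ennreal_mult')
    finally show "(\<integral>\<^sup>+ x. ennreal (exp (r * \<xi> * g x) * std_normal_density \<xi>) \<partial>M)
        \<le> ennreal (\<sigma> * exp ((r * m)\<^sup>2 * \<sigma>\<^sup>2 / 2)) * ennreal (normal_density (r * m * \<sigma>\<^sup>2) \<sigma> \<xi>)" .
  qed
  also have "\<dots> = ennreal (\<sigma> * exp ((r * m)\<^sup>2 * \<sigma>\<^sup>2 / 2))"
    by (subst nn_integral_cmult) (auto simp: nn_integral_normal_density pos)
  also have "(r * m)\<^sup>2 * \<sigma>\<^sup>2 / 2 = s * m\<^sup>2 * \<sigma>\<^sup>2"
    by (simp add: power_mult_distrib r2)
  also have "\<dots> = s * m\<^sup>2 / (1 - 4 * s)" by (simp add: s2)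
  finally show ?thesis using pos by (simp add: \<sigma>_def)
qed

lemma le_exp_if_ln_le: "0 < a \<Longrightarrow> ln a \<le> c \<Longrightarrow> a \<le> exp c" for a c :: real
  by (metis exp_le_cancel_iff exp_ln)

text \<open>
  Lowering the exponent by the factor \<open>2/3\<close> takes the power \<open>2/3\<close> of the bound \<open>2\<^bsup>3/2\<^esup>\<close>, by
  Jensen. Instead of the power function, the tangent at the extremal value \<open>sqrt 2\<close> is used: for
  \<open>w \<ge> 0\<close>, \<open>0 \<le> (w - sqrt 2)\<^sup>2 (2 w + sqrt 2)\<close> compares \<open>w\<^sup>2\<close> with \<open>w\<^sup>3\<close>.
\<close>

lemma (in prob_space) two_thirds_moment_le_two:
  assumes f: "bdd_meas M f"
    and le: "(\<integral>x. exp (T * \<bar>f x\<bar>) \<partial>M) \<le> 2 * sqrt 2"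
  shows "(\<integral>x. exp (2 / 3 * T * \<bar>f x\<bar>) \<partial>M) \<le> 2"
proof -
  define w where "w = (\<lambda>x. exp (T / 3 * \<bar>f x\<bar>))"
  have w: "bdd_meas M w" unfolding w_def by (intro bdd_meas_intros f)
  have w2: "exp (2 / 3 * T * \<bar>f x\<bar>) = (w x)\<^sup>2" and w3: "exp (T * \<bar>f x\<bar>) = (w x) ^ 3" for x
    by (simp_all add: w_def flip: exp_of_nat_mult)
  have young: "3 * sqrt 2 * (w x)\<^sup>2 \<le> 2 * (w x) ^ 3 + 2 * sqrt 2" for x
  proof -
    have "0 \<le> (w x - sqrt 2)\<^sup>2 * (2 * w x + sqrt 2)" by (intro mult_nonneg_nonneg) (auto simp: w_def add_nonneg_nonneg)
    also have "\<dots> = 2 * (w x) ^ 3 - 3 * sqrt 2 * (w x)\<^sup>2 + sqrt 2 * (sqrt 2 * sqrt 2)"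
      by (simp add: power2_eq_square power3_eq_cube algebra_simps)
    finally show ?thesis by simp
  qed
  have "3 * sqrt 2 * (\<integral>x. (w x)\<^sup>2 \<partial>M) = (\<integral>x. 3 * sqrt 2 * (w x)\<^sup>2 \<partial>M)" by simp
  also have "\<dots> \<le> (\<integral>x. 2 * (w x) ^ 3 + 2 * sqrt 2 \<partial>M)"
    by (rule integral_mono, (intro integrable_bdd_meas bdd_meas_intros w)+, rule young)
  also have "\<dots> = 2 * (\<integral>x. (w x) ^ 3 \<partial>M) + 2 * sqrt 2"
    by (subst Bochner_Integration.integral_add, (intro integrable_bdd_meas bdd_meas_intros w)+) (simp add: prob_space)
  also have "\<dots> \<le> 2 * (2 * sqrt 2) + 2 * sqrt 2" using le by (simp add: w3)
  finally show ?thesis unfolding w2 by simp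
qed

text \<open>
  \<open>T\<close> is \<open>3/2\<close> times the exponent \<open>1 / (2 (3 + B))\<close> of the final estimate, with \<open>B\<close> in place of
  \<open>b\<^sup>2\<close>. The two inputs \<open>ln (5/3) \<le> 3/4 ln 2\<close>, which is \<open>5\<^sup>4 \<le> 8 \<cdot> 3\<^sup>4\<close>, and \<open>2/3 \<le> ln 2\<close> leave some
  room for all \<open>B \<ge> 0\<close>.
\<close>

lemma exponent_numerics:
  fixes B :: real
  assumes B: "B \<ge> 0"
  defines "T \<equiv> 3 / (4 * (3 + B))"
  shows "T\<^sup>2 < 4 / 25" "T\<^sup>2 * (ln (5 / 3) + 4 / 9 * B) / (4 / 25 - T\<^sup>2) \<le> ln 2 / 2"
proof -
  have T: "0 < T" "T \<le> 1 / 4" using B by (auto simp: T_def field_simps)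
  have "T\<^sup>2 \<le> (1 / 4)\<^sup>2" using T by (intro power_mono) auto
  also have "\<dots> < (4 / 25 :: real)" by (simp add: power2_eq_square)
  finally show lt: "T\<^sup>2 < 4 / 25" .
  have "4 * ln (5 / 3 :: real) = ln ((5 / 3) ^ 4)" by (simp add: ln_realpow)
  also have "\<dots> \<le> ln (2 ^ 3)" by (subst ln_le_cancel_iff) (auto simp: power_divide)
  also have "\<dots> = 3 * ln (2 :: real)" by (subst ln_realpow) auto
  finally have l1: "ln (5 / 3 :: real) \<le> 3 / 4 * ln 2" by simp
  have l2: "ln (2 :: real) \<ge> 2 / 3" by (rule ln2_ge_two_thirds)
  have "ln (5 / 3) + 4 / 9 * B \<le> 3 / 4 * ln 2 + (2 / 3 * ln 2) * B"
    using l1 l2 B by (intro add_mono mult_right_mono) auto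
  also have "\<dots> = ln 2 * (3 / 4 + 2 / 3 * B)" by (simp add: algebra_simps)
  also have "\<dots> \<le> ln 2 * (1 / 2 * (64 / 225 * (3 + B)\<^sup>2 - 1))"
    using B by (intro mult_left_mono) (auto simp: power2_eq_square algebra_simps)
  finally have "ln (5 / 3) + 4 / 9 * B \<le> ln 2 / 2 * (64 / 225 * (3 + B)\<^sup>2 - 1)" by simp
  then have "T\<^sup>2 * (ln (5 / 3) + 4 / 9 * B) \<le> T\<^sup>2 * (ln 2 / 2 * (64 / 225 * (3 + B)\<^sup>2 - 1))"
    by (intro mult_left_mono) auto
  also have "\<dots> = ln 2 / 2 * (64 / 225 * (T * (3 + B))\<^sup>2 - T\<^sup>2)"
    by (simp only: power_mult_distrib) (simp add: algebra_simps)
  also have "T * (3 + B) = 3 / 4"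
  proof -
    have "3 / (4 * c) * c = 3 / 4" if "c > 0" for c :: real using that by simp
    then show ?thesis using B by (simp only: T_def)
  qed
  finally have "T\<^sup>2 * (ln (5 / 3) + 4 / 9 * B) \<le> ln 2 / 2 * (4 / 25 - T\<^sup>2)" by (simp add: power2_eq_square)
  then show "T\<^sup>2 * (ln (5 / 3) + 4 / 9 * B) / (4 / 25 - T\<^sup>2) \<le> ln 2 / 2"
    using lt by (simp add: pos_divide_le_eq)
qed

section \<open>Averaging out coordinates of a product space\<close>

definition avg :: "('i \<Rightarrow> 'a measure) \<Rightarrow> 'i \<Rightarrow> (('i \<Rightarrow> 'a) \<Rightarrow> real) \<Rightarrow> ('i \<Rightarrow> 'a) \<Rightarrow> real"
  where "avg M i u x = (\<integral>y. u (x(i := y)) \<partial>M i)"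

text \<open>
  This and \<open>mixed_var\<close> are the squares of the difference operators of first and second order.
\<close>

definition resample_var :: "('i \<Rightarrow> 'a measure) \<Rightarrow> 'i \<Rightarrow> (('i \<Rightarrow> 'a) \<Rightarrow> real) \<Rightarrow> ('i \<Rightarrow> 'a) \<Rightarrow> real"
  where "resample_var M i u x = 1 / 2 * (\<integral>y. (u x - u (x(i := y)))\<^sup>2 \<partial>M i)"

definition mixed_var :: "('i \<Rightarrow> 'a measure) \<Rightarrow> 'i \<Rightarrow> 'i \<Rightarrow> (('i \<Rightarrow> 'a) \<Rightarrow> real) \<Rightarrow> ('i \<Rightarrow> 'a) \<Rightarrow> real"
  where "mixed_var M i j f x = 1 / 4 * (\<integral>yi. (\<integral>yj. (f x - f (x(i := yi)) - f (x(j := yj))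
                                  + f (x(i := yi, j := yj)))\<^sup>2 \<partial>M j) \<partial>M i)"

lemma avg_update [simp]: "avg M i u (x(i := y)) = avg M i u x"
  by (simp add: avg_def)

lemma (in prob_space) half_square_difference:
  assumes \<phi>: "bdd_meas M \<phi>"
  shows "(\<integral>y. 1 / 2 * (\<integral>z. (\<phi> y - \<phi> z)\<^sup>2 \<partial>M) \<partial>M) = (\<integral>y. (\<phi> y - (\<integral>z. \<phi> z \<partial>M))\<^sup>2 \<partial>M)"
proof -
  note bm = integrable_bdd_meas bdd_meas_intros \<phi>
  let ?m = "\<integral>z. \<phi> z \<partial>M" and ?q = "\<integral>z. (\<phi> z)\<^sup>2 \<partial>M"
  have sq: "(\<integral>z. (a - \<phi> z)\<^sup>2 \<partial>M) = a\<^sup>2 - 2 * a * ?m + ?q" for a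
  proof -
    have "(\<integral>z. (a - \<phi> z)\<^sup>2 \<partial>M) = (\<integral>z. (a\<^sup>2 - 2 * a * \<phi> z) + (\<phi> z)\<^sup>2 \<partial>M)"
      by (intro Bochner_Integration.integral_cong) (auto simp: power2_eq_square algebra_simps)
    also have "\<dots> = (\<integral>z. a\<^sup>2 - 2 * a * \<phi> z \<partial>M) + ?q"
      by (rule Bochner_Integration.integral_add; intro bm)
    also have "(\<integral>z. a\<^sup>2 - 2 * a * \<phi> z \<partial>M) = a\<^sup>2 - 2 * a * ?m"
      by (subst Bochner_Integration.integral_diff, (intro bm)+) (simp add: prob_space)
    finally show ?thesis .
  qed
  have "(\<integral>y. (\<phi> y - ?m)\<^sup>2 \<partial>M) = ?q - ?m\<^sup>2"
  proof -
    have "(\<integral>y. (\<phi> y - ?m)\<^sup>2 \<partial>M) = (\<integral>y. (?m - \<phi> y)\<^sup>2 \<partial>M)" by (simp add: power2_commute)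
    then show ?thesis unfolding sq by (simp add: power2_eq_square)
  qed
  moreover have "(\<integral>y. 1 / 2 * (\<integral>z. (\<phi> y - \<phi> z)\<^sup>2 \<partial>M) \<partial>M) = (\<integral>y. 1 / 2 * ((\<phi> y)\<^sup>2 - 2 * ?m * \<phi> y) + 1 / 2 * ?q \<partial>M)"
    unfolding sq by (intro Bochner_Integration.integral_cong) (auto simp: algebra_simps)
  moreover have "\<dots> = (\<integral>y. 1 / 2 * ((\<phi> y)\<^sup>2 - 2 * ?m * \<phi> y) \<partial>M) + 1 / 2 * ?q"
    by (subst Bochner_Integration.integral_add, (intro bm)+) (simp add: prob_space)
  moreover have "(\<integral>y. 1 / 2 * ((\<phi> y)\<^sup>2 - 2 * ?m * \<phi> y) \<partial>M) = 1 / 2 * (?q - 2 * ?m * ?m)"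
    by (simp only: integral_mult_right_zero, subst Bochner_Integration.integral_diff, (intro bm)+) simp
  ultimately show ?thesis by (simp add: power2_eq_square)
qed

context finite_product_prob_space
begin

abbreviation \<mu> :: "('a \<Rightarrow> 'b) measure" where "\<mu> \<equiv> PiM I M"

definition free_of :: "'a set \<Rightarrow> (('a \<Rightarrow> 'b) \<Rightarrow> real) \<Rightarrow> bool"
  where "free_of J \<phi> \<longleftrightarrow> (\<forall>x\<in>space \<mu>. \<forall>j\<in>J. \<forall>y\<in>space (M j). \<phi> (x(j := y)) = \<phi> x)"

text \<open>
  \<open>v\<close> is the conditional expectation of \<open>u\<close> given the coordinates outside \<open>J\<close>, described by
  the property that characterises it. This avoids iterated integrals over \<open>J\<close> and any question
  of the order of integration.
\<close>

definition averages :: "'a set \<Rightarrow> (('a \<Rightarrow> 'b) \<Rightarrow> real) \<Rightarrow> (('a \<Rightarrow> 'b) \<Rightarrow> real) \<Rightarrow> bool"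
  where "averages J u v \<longleftrightarrow> bdd_meas \<mu> v \<and> free_of J v \<and>
    (\<forall>\<phi>. bdd_meas \<mu> \<phi> \<longrightarrow> free_of J \<phi> \<longrightarrow> (\<integral>x. \<phi> x * u x \<partial>\<mu>) = (\<integral>x. \<phi> x * v x \<partial>\<mu>))"

lemma averagesD:
  "averages J u v \<Longrightarrow> bdd_meas \<mu> \<phi> \<Longrightarrow> free_of J \<phi> \<Longrightarrow> (\<integral>x. \<phi> x * u x \<partial>\<mu>) = (\<integral>x. \<phi> x * v x \<partial>\<mu>)"
  "averages J u v \<Longrightarrow> bdd_meas \<mu> v"
  "averages J u v \<Longrightarrow> free_of J v"
  unfolding averages_def by blast+

lemma update_in_space: "x \<in> space \<mu> \<Longrightarrow> i \<in> I \<Longrightarrow> y \<in> space (M i) \<Longrightarrow> x(i := y) \<in> space \<mu>"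
  by (auto simp: space_PiM PiE_iff extensional_def)

lemma measurable_update_pair:
  "i \<in> I \<Longrightarrow> (\<lambda>p. (fst p)(i := snd p)) \<in> measurable (\<mu> \<Otimes>\<^sub>M M i) \<mu>"
  by (rule measurable_fun_upd[where J = I]) auto

lemma measurable_update_slice:
  "i \<in> I \<Longrightarrow> x \<in> space \<mu> \<Longrightarrow> (\<lambda>y. x(i := y)) \<in> measurable (M i) \<mu>"
  by (rule measurable_fun_upd[where J = I]) auto

lemma bdd_meas_slice:
  "bdd_meas \<mu> u \<Longrightarrow> i \<in> I \<Longrightarrow> x \<in> space \<mu> \<Longrightarrow> bdd_meas (M i) (\<lambda>y. u (x(i := y)))"
  by (rule bdd_meas_compose[OF _ measurable_update_slice])

lemma bdd_meas_update_pair: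
  "bdd_meas \<mu> u \<Longrightarrow> i \<in> I \<Longrightarrow> bdd_meas (\<mu> \<Otimes>\<^sub>M M i) (\<lambda>p. u ((fst p)(i := snd p)))"
  by (rule bdd_meas_compose[OF _ measurable_update_pair])

lemma bdd_meas_avg: "bdd_meas \<mu> u \<Longrightarrow> i \<in> I \<Longrightarrow> bdd_meas \<mu> (avg M i u)"
  unfolding avg_def[abs_def] by (intro M.bdd_meas_integral bdd_meas_update_pair)

lemma bdd_meas_resample_var: "bdd_meas \<mu> u \<Longrightarrow> i \<in> I \<Longrightarrow> bdd_meas \<mu> (resample_var M i u)"
  unfolding resample_var_def[abs_def]
  by (intro M.bdd_meas_integral bdd_meas_update_pair bdd_meas_intros)

text \<open>
  Both measures agree on boxes: the preimage of a box is the box with its side \<open>i\<close> enlarged to the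
  whole factor, times that side. Together with Fubini this yields \<open>integral_update\<close>.
\<close>

lemma distr_update:
  assumes i: "i \<in> I"
  shows "distr (\<mu> \<Otimes>\<^sub>M M i) \<mu> (\<lambda>p. (fst p)(i := snd p)) = \<mu>"
proof (rule PiM_eqI)
  fix A assume A: "\<And>j. j \<in> I \<Longrightarrow> A j \<in> sets (M j)"
  define B where "B = (\<lambda>j. if j = i then space (M i) else A j)"
  have B: "\<And>j. j \<in> I \<Longrightarrow> B j \<in> sets (M j)" using A by (auto simp: B_def)
  have sp: "x j \<in> space (M j)" if "x \<in> space \<mu>" "j \<in> I" for x j
    using that by (auto simp: space_PiM)
  have As: "y \<in> space (M j)" if "y \<in> A j" "j \<in> I" for y j
    using that A sets.sets_into_space by blast
  have "(\<lambda>p. (fst p)(i := snd p)) -` (Pi\<^sub>E I A) \<inter> space (\<mu> \<Otimes>\<^sub>M M i) = Pi\<^sub>E I B \<times> A i"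
    using i As by (fastforce simp: space_pair_measure space_PiM PiE_iff extensional_def B_def split: if_splits)
  then have "emeasure (distr (\<mu> \<Otimes>\<^sub>M M i) \<mu> (\<lambda>p. (fst p)(i := snd p))) (Pi\<^sub>E I A)
      = emeasure (\<mu> \<Otimes>\<^sub>M M i) (Pi\<^sub>E I B \<times> A i)"
    by (subst emeasure_distr[OF measurable_update_pair[OF i]]) (auto intro!: sets_PiM_I_finite A finite_index)
  also have "\<dots> = emeasure \<mu> (Pi\<^sub>E I B) * emeasure (M i) (A i)"
    by (rule M.emeasure_pair_measure_Times) (auto intro!: sets_PiM_I_finite A B i finite_index)
  also have "emeasure \<mu> (Pi\<^sub>E I B) = (\<Prod>j\<in>I. emeasure (M j) (B j))"
    using B finite_index by (intro emeasure_PiM) auto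
  also have "\<dots> = (\<Prod>j\<in>I - {i}. emeasure (M j) (A j))"
    using i finite_index by (subst prod.remove[of _ i]) (auto simp: B_def M.emeasure_space_1 intro!: prod.cong)
  also have "\<dots> * emeasure (M i) (A i) = (\<Prod>j\<in>I. emeasure (M j) (A j))"
    using i finite_index by (subst (2) prod.remove[of _ i]) (auto simp: mult.commute)
  finally show "emeasure (distr (\<mu> \<Otimes>\<^sub>M M i) \<mu> (\<lambda>p. (fst p)(i := snd p))) (Pi\<^sub>E I A)
    = (\<Prod>j\<in>I. emeasure (M j) (A j))" .
qed (auto intro: finite_index)

lemma integral_update:
  fixes G :: "('a \<Rightarrow> 'b) \<Rightarrow> real"
  assumes i: "i \<in> I" and G: "integrable \<mu> G"
  shows "(\<integral>x. G x \<partial>\<mu>) = (\<integral>x. \<integral>y. G (x(i := y)) \<partial>M i \<partial>\<mu>)"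
proof -
  interpret Q: pair_prob_space \<mu> "M i" ..
  have [measurable]: "G \<in> borel_measurable \<mu>" using G by auto
  have int: "integrable (\<mu> \<Otimes>\<^sub>M M i) (\<lambda>p. G ((fst p)(i := snd p)))"
    using integrable_distr[OF measurable_update_pair[OF i], of G] G by (simp add: distr_update i)
  have "(\<integral>x. G x \<partial>\<mu>) = (\<integral>x. G x \<partial>distr (\<mu> \<Otimes>\<^sub>M M i) \<mu> (\<lambda>p. (fst p)(i := snd p)))"
    by (simp add: distr_update i)
  also have "\<dots> = (\<integral>p. G ((fst p)(i := snd p)) \<partial>(\<mu> \<Otimes>\<^sub>M M i))"
    by (rule integral_distr[OF measurable_update_pair[OF i]]) simp
  also have "\<dots> = (\<integral>x. \<integral>y. G (x(i := y)) \<partial>M i \<partial>\<mu>)"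
    using Q.integral_fst'[OF int] by simp
  finally show ?thesis .
qed

lemma integral_avg: "i \<in> I \<Longrightarrow> integrable \<mu> G \<Longrightarrow> (\<integral>x. avg M i G x \<partial>\<mu>) = (\<integral>x. G x \<partial>\<mu>)"
  by (simp add: avg_def integral_update)

lemma free_ofD: "free_of J \<phi> \<Longrightarrow> x \<in> space \<mu> \<Longrightarrow> j \<in> J \<Longrightarrow> y \<in> space (M j) \<Longrightarrow> \<phi> (x(j := y)) = \<phi> x"
  by (auto simp: free_of_def)

lemma free_of_avg:
  assumes "free_of J \<phi>" "k \<in> I"
  shows "free_of (insert k J) (avg M k \<phi>)"
  unfolding free_of_def
proof (intro ballI)
  fix x j y assume x: "x \<in> space \<mu>" and j: "j \<in> insert k J" and y: "y \<in> space (M j)"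
  show "avg M k \<phi> (x(j := y)) = avg M k \<phi> x"
  proof (cases "j = k")
    case False
    then have "\<phi> (x(j := y, k := z)) = \<phi> (x(k := z))" if "z \<in> space (M k)" for z
      using free_ofD[OF assms(1) update_in_space[OF x assms(2) that], of j y] j y
      by (simp add: fun_upd_twist)
    then show ?thesis unfolding avg_def by (intro Bochner_Integration.integral_cong) auto
  qed simp
qed

lemma free_of_mono: "free_of J \<phi> \<Longrightarrow> K \<subseteq> J \<Longrightarrow> free_of K \<phi>"
  by (auto simp: free_of_def)

lemma avg_mult_free:
  assumes "free_of {k} \<phi>" "x \<in> space \<mu>"
  shows "avg M k (\<lambda>x. \<phi> x * u x) x = \<phi> x * avg M k u x"
proof -
  have "(\<integral>y. \<phi> (x(k := y)) * u (x(k := y)) \<partial>M k) = (\<integral>y. \<phi> x * u (x(k := y)) \<partial>M k)"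
    using assms by (intro Bochner_Integration.integral_cong) (auto simp: free_of_def)
  then show ?thesis by (simp add: avg_def)
qed

lemma integral_mult_avg:
  assumes k: "k \<in> I" and \<phi>: "bdd_meas \<mu> \<phi>" "free_of {k} \<phi>" and u: "bdd_meas \<mu> u"
  shows "(\<integral>x. \<phi> x * avg M k u x \<partial>\<mu>) = (\<integral>x. \<phi> x * u x \<partial>\<mu>)"
proof -
  have "(\<integral>x. \<phi> x * avg M k u x \<partial>\<mu>) = (\<integral>x. avg M k (\<lambda>x. \<phi> x * u x) x \<partial>\<mu>)"
    by (intro Bochner_Integration.integral_cong) (auto simp: avg_mult_free[OF \<phi>(2)])
  also have "\<dots> = (\<integral>x. \<phi> x * u x \<partial>\<mu>)"
    by (rule integral_avg[OF k]) (intro integrable_bdd_meas bdd_meas_intros \<phi> u)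
  finally show ?thesis .
qed

lemma avg_self_adjoint:
  assumes k: "k \<in> I" and \<phi>: "bdd_meas \<mu> \<phi>" and u: "bdd_meas \<mu> u"
  shows "(\<integral>x. \<phi> x * avg M k u x \<partial>\<mu>) = (\<integral>x. avg M k \<phi> x * u x \<partial>\<mu>)"
proof -
  have fr: "free_of {k} (avg M k v)" for v
    using free_of_avg[of "{}" v k] k by (simp add: free_of_def)
  have "(\<integral>x. \<phi> x * avg M k u x \<partial>\<mu>) = (\<integral>x. avg M k u x * \<phi> x \<partial>\<mu>)" by (simp add: mult.commute)
  also have "\<dots> = (\<integral>x. avg M k u x * avg M k \<phi> x \<partial>\<mu>)"
    by (rule integral_mult_avg[symmetric]) (intro k \<phi> u fr bdd_meas_avg)+
  also have "\<dots> = (\<integral>x. avg M k \<phi> x * avg M k u x \<partial>\<mu>)" by (simp add: mult.commute)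
  also have "\<dots> = (\<integral>x. avg M k \<phi> x * u x \<partial>\<mu>)"
    by (rule integral_mult_avg) (intro k \<phi> u fr bdd_meas_avg)+
  finally show ?thesis .
qed

text \<open>
  Conditional expectations are built up one coordinate at a time; the inductive proofs of
  entropy subadditivity and of the Efron--Stein inequality both telescope along this chain.
\<close>

lemma averages_insert:
  assumes v: "averages J u v" and k: "k \<in> I"
  shows "averages (insert k J) u (avg M k v)"
  unfolding averages_def
proof (intro conjI allI impI)
  show "bdd_meas \<mu> (avg M k v)" using v k by (auto simp: averages_def intro: bdd_meas_avg)
  show "free_of (insert k J) (avg M k v)" using v k by (auto simp: averages_def intro: free_of_avg)
  fix \<phi> assume \<phi>: "bdd_meas \<mu> \<phi>" "free_of (insert k J) \<phi>"
  have "(\<integral>x. \<phi> x * u x \<partial>\<mu>) = (\<integral>x. \<phi> x * v x \<partial>\<mu>)"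
    using v \<phi> free_of_mono[OF \<phi>(2), of J] unfolding averages_def by blast
  also have "\<dots> = (\<integral>x. \<phi> x * avg M k v x \<partial>\<mu>)"
    by (rule integral_mult_avg[symmetric]) (use v \<phi> k free_of_mono[OF \<phi>(2), of "{k}"] in \<open>auto simp: averages_def\<close>)
  finally show "(\<integral>x. \<phi> x * u x \<partial>\<mu>) = (\<integral>x. \<phi> x * avg M k v x \<partial>\<mu>)" .
qed

text \<open>
  Two points of a finite product are joined by changing one coordinate after the other.
\<close>

lemma free_of_all_const:
  assumes v: "free_of I v" and x: "x \<in> space \<mu>" and y: "y \<in> space \<mu>"
  shows "v x = v y"
proof -
  have "finite J \<Longrightarrow> J \<subseteq> I \<Longrightarrow> (\<lambda>i. if i \<in> J then y i else x i) \<in> space \<mu> \<and>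
     v (\<lambda>i. if i \<in> J then y i else x i) = v x" for J
  proof (induction J rule: finite_induct)
    case (insert k J)
    let ?z = "\<lambda>i. if i \<in> J then y i else x i"
    have eq: "(\<lambda>i. if i \<in> insert k J then y i else x i) = ?z(k := y k)" by auto
    have k: "k \<in> I" "y k \<in> space (M k)" using insert y by (auto simp: space_PiM)
    then show ?case using insert free_ofD[OF v, of ?z k "y k"] update_in_space[of ?z k "y k"]
      unfolding eq by auto
  qed (use x in auto)
  moreover have "(\<lambda>i. if i \<in> I then y i else x i) = y"
    using x y by (auto simp: space_PiM PiE_iff extensional_def)
  ultimately show ?thesis using finite_index by fastforce
qed

section \<open>The modified logarithmic Sobolev inequality\<close>

text \<open>
  Averaging is carried out on the density \<open>e\<^sup>u\<close>, but only its logarithm is recorded, so that all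
  densities keep the form \<open>e\<^sup>v\<close> with bounded \<open>v\<close>.
\<close>

definition log_avg :: "'a \<Rightarrow> (('a \<Rightarrow> 'b) \<Rightarrow> real) \<Rightarrow> ('a \<Rightarrow> 'b) \<Rightarrow> real"
  where "log_avg i u x = ln (avg M i (\<lambda>x. exp (u x)) x)"

lemma avg_exp_pos: "bdd_meas \<mu> u \<Longrightarrow> i \<in> I \<Longrightarrow> x \<in> space \<mu> \<Longrightarrow> 0 < avg M i (\<lambda>x. exp (u x)) x"
  unfolding avg_def by (intro M.integral_exp_pos bdd_meas_slice)

lemma exp_log_avg:
  "bdd_meas \<mu> u \<Longrightarrow> i \<in> I \<Longrightarrow> x \<in> space \<mu> \<Longrightarrow> exp (log_avg i u x) = avg M i (\<lambda>x. exp (u x)) x"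
  by (simp add: log_avg_def avg_exp_pos)

lemma bdd_meas_log_avg:
  assumes u: "bdd_meas \<mu> u" and i: "i \<in> I"
  shows "bdd_meas \<mu> (log_avg i u)"
proof -
  obtain C where C: "\<And>x. x \<in> space \<mu> \<Longrightarrow> \<bar>u x\<bar> \<le> C" using bdd_meas_bound[OF u] by blast
  have bm: "bdd_meas \<mu> (avg M i (\<lambda>x. exp (u x)))" by (intro bdd_meas_avg bdd_meas_intros u i)
  show ?thesis
  proof (rule bdd_measI[of _ _ C])
    show "log_avg i u \<in> borel_measurable \<mu>"
      unfolding log_avg_def[abs_def] using bm by measurable
    fix x assume x: "x \<in> space \<mu>"
    note sl = bdd_meas_exp[OF bdd_meas_slice[OF u i x]]
    have C': "-C \<le> u (x(i := y))" "u (x(i := y)) \<le> C" if "y \<in> space (M i)" for y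
      using C[OF update_in_space[OF x i that]] by auto
    have "avg M i (\<lambda>x. exp (u x)) x \<le> (\<integral>y. exp C \<partial>M i)" unfolding avg_def
      by (rule integral_mono) (auto intro!: M.integrable_bdd_meas sl C')
    then have "avg M i (\<lambda>x. exp (u x)) x \<le> exp C" by (simp add: M.prob_space)
    moreover have "(\<integral>y. exp (-C) \<partial>M i) \<le> avg M i (\<lambda>x. exp (u x)) x" unfolding avg_def
      by (rule integral_mono) (auto intro!: M.integrable_bdd_meas sl C')
    then have "exp (-C) \<le> avg M i (\<lambda>x. exp (u x)) x" by (simp add: M.prob_space)
    ultimately show "\<bar>log_avg i u x\<bar> \<le> C"
      using avg_exp_pos[OF u i x] ln_le_cancel_iff[of "avg M i (\<lambda>x. exp (u x)) x" "exp C"]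
        ln_le_cancel_iff[of "exp (-C)" "avg M i (\<lambda>x. exp (u x)) x"]
      unfolding log_avg_def by simp
  qed
qed

lemma averages_cong:
  assumes "averages J u v" "\<And>x. x \<in> space \<mu> \<Longrightarrow> v x = w x" "J \<subseteq> I"
  shows "averages J u w"
proof -
  have "w \<in> borel_measurable \<mu> \<longleftrightarrow> v \<in> borel_measurable \<mu>"
    by (rule measurable_cong) (simp add: assms(2))
  then have "bdd_meas \<mu> w"
    using assms(1) by (simp add: averages_def bdd_meas_def assms(2))
  moreover have "free_of J w"
    unfolding free_of_def
  proof (intro ballI)
    fix x j y assume x: "x \<in> space \<mu>" and j: "j \<in> J" and y: "y \<in> space (M j)"
    have "v (x(j := y)) = v x" using assms(1) x j y by (simp add: averages_def free_of_def)
    then show "w (x(j := y)) = w x"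
      using assms(2)[OF x] assms(2)[OF update_in_space[OF x _ y]] j assms(3) by auto
  qed
  moreover have "(\<integral>x. \<phi> x * v x \<partial>\<mu>) = (\<integral>x. \<phi> x * w x \<partial>\<mu>)" for \<phi>
    by (intro Bochner_Integration.integral_cong) (auto simp: assms(2))
  ultimately show ?thesis using assms(1) by (simp add: averages_def)
qed

lemma free_of_comp: "free_of J u \<Longrightarrow> free_of J (\<lambda>x. g (u x))"
  by (simp add: free_of_def)

lemma free_of_log_avg:
  assumes "free_of J u" "k \<in> I"
  shows "free_of (insert k J) (log_avg k u)"
  unfolding log_avg_def[abs_def]
  by (rule free_of_comp[where g = ln, OF free_of_avg[OF free_of_comp[where g = exp, OF assms(1)] assms(2)]])

text \<open>
  When \<open>e\<^sup>v\<close> is the conditional expectation of \<open>e\<^sup>u\<close>, averaging out one more coordinate \<open>k\<close>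
  leads to \<open>e\<^sup>w\<close> with \<open>w = log_avg k v\<close>. The increment \<open>v - w\<close>, paired with \<open>e\<^sup>u\<close>, is at most
  \<open>u - log_avg k u\<close>: by the Gibbs inequality it is enough that the density
  \<open>exp (v - w + log_avg k u)\<close> has the same mass as \<open>e\<^sup>u\<close>. This follows from moving the average
  over \<open>k\<close> to the other factor, where \<open>e\<^sup>u\<close> may be replaced by \<open>e\<^sup>v\<close>, and back.
\<close>

lemma entropy_telescope:
  assumes u: "bdd_meas \<mu> u" and "finite J" "J \<subseteq> I"
  shows "\<exists>v. bdd_meas \<mu> v \<and> free_of J v \<and> averages J (\<lambda>x. exp (u x)) (\<lambda>x. exp (v x)) \<and>
    (\<integral>x. exp (u x) * (u x - v x) \<partial>\<mu>) \<le> (\<Sum>j\<in>J. \<integral>x. exp (u x) * (u x - log_avg j u x) \<partial>\<mu>)"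
  using assms(2,3)
proof (induction J rule: finite_induct)
  case empty
  show ?case by (rule exI[of _ u]) (auto simp: averages_def free_of_def intro!: bdd_meas_intros u)
next
  case (insert k J)
  from insert.IH insert.prems obtain v where v: "bdd_meas \<mu> v" "free_of J v"
    and av: "averages J (\<lambda>x. exp (u x)) (\<lambda>x. exp (v x))"
    and le: "(\<integral>x. exp (u x) * (u x - v x) \<partial>\<mu>) \<le> (\<Sum>j\<in>J. \<integral>x. exp (u x) * (u x - log_avg j u x) \<partial>\<mu>)"
    by auto
  have k: "k \<in> I" using insert by auto
  let ?w = "log_avg k v"
  note bm = bdd_meas_intros bdd_meas_log_avg bdd_meas_avg u v k
  have avw: "averages (insert k J) (\<lambda>x. exp (u x)) (\<lambda>x. exp (?w x))"
    using insert by (intro averages_cong[OF averages_insert[OF av k]]) (auto simp: exp_log_avg v k)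
  have swap: "(\<integral>x. \<phi> x * exp (u x) \<partial>\<mu>) = (\<integral>x. \<phi> x * exp (v x) \<partial>\<mu>)"
    if "bdd_meas \<mu> \<phi>" "free_of J \<phi>" for \<phi>
    by (rule averagesD(1)[OF av that])
  have fw: "free_of J ?w" by (rule free_of_mono[OF free_of_log_avg[OF v(2) k]]) auto
  let ?\<phi> = "\<lambda>x. exp (v x - ?w x)"
  have \<phi>: "bdd_meas \<mu> ?\<phi>" by (intro bm)
  have \<phi>_free: "free_of J ?\<phi>"
    unfolding free_of_def by (intro ballI) (simp only: free_ofD[OF v(2)] free_ofD[OF fw])
  have "(\<integral>x. exp (u x) * (v x - ?w x + log_avg k u x) \<partial>\<mu>) \<le> (\<integral>x. exp (u x) * u x \<partial>\<mu>)"
  proof (rule gibbs_inequality)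
    have "(\<integral>x. exp (v x - ?w x + log_avg k u x) \<partial>\<mu>) = (\<integral>x. ?\<phi> x * avg M k (\<lambda>x. exp (u x)) x \<partial>\<mu>)"
      by (intro Bochner_Integration.integral_cong) (auto simp: exp_add exp_log_avg u k)
    also have "\<dots> = (\<integral>x. avg M k ?\<phi> x * exp (u x) \<partial>\<mu>)"
      by (rule avg_self_adjoint; intro bm)
    also have "\<dots> = (\<integral>x. avg M k ?\<phi> x * exp (v x) \<partial>\<mu>)"
      using free_of_mono[OF free_of_avg[OF \<phi>_free k], of J] by (intro swap bm) auto
    also have "\<dots> = (\<integral>x. ?\<phi> x * avg M k (\<lambda>x. exp (v x)) x \<partial>\<mu>)"
      by (rule avg_self_adjoint[symmetric]; intro bm)
    also have "\<dots> = (\<integral>x. 1 * exp (v x) \<partial>\<mu>)"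
      by (intro Bochner_Integration.integral_cong) (auto simp: exp_diff exp_log_avg v k avg_exp_pos less_imp_neq[OF avg_exp_pos, symmetric])
    also have "\<dots> = (\<integral>x. 1 * exp (u x) \<partial>\<mu>)"
      by (rule swap[symmetric], intro bm) (simp add: free_of_def)
    finally show "(\<integral>x. exp (v x - ?w x + log_avg k u x) \<partial>\<mu>) \<le> (\<integral>x. exp (u x) \<partial>\<mu>)" by simp
  qed (intro bm)+
  moreover have "(\<integral>x. exp (u x) * (v x - ?w x + log_avg k u x) \<partial>\<mu>) =
      (\<integral>x. exp (u x) * (v x - ?w x) \<partial>\<mu>) + (\<integral>x. exp (u x) * log_avg k u x \<partial>\<mu>)"
    unfolding distrib_left by (rule Bochner_Integration.integral_add; intro integrable_bdd_meas bm)
  moreover have "(\<integral>x. exp (u x) * (u x - log_avg k u x) \<partial>\<mu>) =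
      (\<integral>x. exp (u x) * u x \<partial>\<mu>) - (\<integral>x. exp (u x) * log_avg k u x \<partial>\<mu>)"
    unfolding right_diff_distrib by (rule Bochner_Integration.integral_diff; intro integrable_bdd_meas bm)
  moreover have "(\<integral>x. exp (u x) * (u x - ?w x) \<partial>\<mu>) =
      (\<integral>x. exp (u x) * (u x - v x) \<partial>\<mu>) + (\<integral>x. exp (u x) * (v x - ?w x) \<partial>\<mu>)"
  proof -
    have "(\<integral>x. exp (u x) * (u x - ?w x) \<partial>\<mu>) = (\<integral>x. exp (u x) * (u x - v x) + exp (u x) * (v x - ?w x) \<partial>\<mu>)"
      by (simp add: distrib_left[symmetric])
    also have "\<dots> = (\<integral>x. exp (u x) * (u x - v x) \<partial>\<mu>) + (\<integral>x. exp (u x) * (v x - ?w x) \<partial>\<mu>)"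
      by (rule Bochner_Integration.integral_add; intro integrable_bdd_meas bm)
    finally show ?thesis .
  qed
  ultimately have "(\<integral>x. exp (u x) * (u x - ?w x) \<partial>\<mu>)
      \<le> (\<Sum>j\<in>insert k J. (\<integral>x. exp (u x) * (u x - log_avg j u x) \<partial>\<mu>))"
    using le insert.hyps by simp
  moreover have "bdd_meas \<mu> ?w" by (intro bm)
  ultimately show ?case
    by (intro exI[of _ ?w] conjI avw free_of_log_avg[OF v(2) k])
qed

text \<open>
  After all coordinates have been averaged out, \<open>v\<close> is the constant \<open>ln (\<integral>e\<^sup>u)\<close>.
\<close>

lemma entropy_subadditive:
  assumes u: "bdd_meas \<mu> u"
  shows "exp_entropy \<mu> u \<le> (\<Sum>i\<in>I. \<integral>x. exp (u x) * (u x - log_avg i u x) \<partial>\<mu>)"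
proof -
  obtain v where v: "bdd_meas \<mu> v" "free_of I v"
    and av: "averages I (\<lambda>x. exp (u x)) (\<lambda>x. exp (v x))"
    and le: "(\<integral>x. exp (u x) * (u x - v x) \<partial>\<mu>) \<le> (\<Sum>j\<in>I. \<integral>x. exp (u x) * (u x - log_avg j u x) \<partial>\<mu>)"
    using entropy_telescope[OF u finite_index order_refl] by auto
  obtain x0 where x0: "x0 \<in> space \<mu>" using prob_space.not_empty[OF P.prob_space_axioms] by blast
  have c: "v x = v x0" if "x \<in> space \<mu>" for x using free_of_all_const[OF v(2) that x0] .
  have "(\<integral>x. 1 * exp (u x) \<partial>\<mu>) = (\<integral>x. 1 * exp (v x) \<partial>\<mu>)"
    using av bdd_meas_const[of \<mu> 1] unfolding averages_def by (auto simp: free_of_def)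
  also have "\<dots> = (\<integral>x. exp (v x0) \<partial>\<mu>)"
    by (intro Bochner_Integration.integral_cong) (auto dest: c)
  finally have Z: "(\<integral>x. exp (u x) \<partial>\<mu>) = exp (v x0)" by (simp add: P.prob_space)
  have "(\<integral>x. exp (u x) * (u x - v x) \<partial>\<mu>) = (\<integral>x. exp (u x) * u x - exp (u x) * v x0 \<partial>\<mu>)"
    by (intro Bochner_Integration.integral_cong) (auto dest: c simp: algebra_simps)
  also have "\<dots> = (\<integral>x. exp (u x) * u x \<partial>\<mu>) - (\<integral>x. exp (u x) * v x0 \<partial>\<mu>)"
    by (rule Bochner_Integration.integral_diff; intro integrable_bdd_meas bdd_meas_intros u)
  also have "\<dots> = exp_entropy \<mu> u" by (simp add: exp_entropy_def Z)
  finally show ?thesis using le by simp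
qed

text \<open>
  Each term of the subadditivity bound is, after integrating over the coordinate \<open>i\<close> first, the
  average of one-dimensional entropies.
\<close>

lemma modified_log_sobolev:
  assumes u: "bdd_meas \<mu> u"
  shows "exp_entropy \<mu> u \<le> (\<integral>x. exp (u x) * (\<Sum>i\<in>I. resample_var M i u x) \<partial>\<mu>)"
proof -
  note bm = bdd_meas_intros bdd_meas_log_avg bdd_meas_avg bdd_meas_resample_var u
  have "(\<integral>x. exp (u x) * (u x - log_avg i u x) \<partial>\<mu>) \<le> (\<integral>x. exp (u x) * resample_var M i u x \<partial>\<mu>)"
    if i: "i \<in> I" for i
  proof -
    have "(\<integral>x. exp (u x) * (u x - log_avg i u x) \<partial>\<mu>) = (\<integral>x. avg M i (\<lambda>x. exp (u x) * (u x - log_avg i u x)) x \<partial>\<mu>)"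
      by (rule integral_avg[symmetric]; intro integrable_bdd_meas bm i)
    also have "\<dots> \<le> (\<integral>x. avg M i (\<lambda>x. exp (u x) * resample_var M i u x) x \<partial>\<mu>)"
    proof (rule integral_mono)
      fix x assume x: "x \<in> space \<mu>"
      let ?p = "\<lambda>y. u (x(i := y))"
      note sl = bdd_meas_slice[OF u i x]
      have "avg M i (\<lambda>x. exp (u x) * (u x - log_avg i u x)) x = (\<integral>y. exp (?p y) * ?p y - exp (?p y) * log_avg i u x \<partial>M i)"
        by (simp add: avg_def log_avg_def algebra_simps)
      also have "\<dots> = exp_entropy (M i) ?p"
        by (subst Bochner_Integration.integral_diff)
          (auto intro!: M.integrable_bdd_meas bdd_meas_intros sl simp: exp_entropy_def log_avg_def avg_def)
      also have "\<dots> \<le> (\<integral>y. exp (?p y) * (1 / 2 * (\<integral>z. (?p y - ?p z)\<^sup>2 \<partial>M i)) \<partial>M i)"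
        by (rule M.exp_entropy_le_gradient[OF sl])
      also have "\<dots> = avg M i (\<lambda>x. exp (u x) * resample_var M i u x) x"
        by (simp add: avg_def resample_var_def)
      finally show "avg M i (\<lambda>x. exp (u x) * (u x - log_avg i u x)) x \<le> avg M i (\<lambda>x. exp (u x) * resample_var M i u x) x" .
    qed (intro integrable_bdd_meas bm i)+
    also have "\<dots> = (\<integral>x. exp (u x) * resample_var M i u x \<partial>\<mu>)"
      by (rule integral_avg; intro integrable_bdd_meas bm i)
    finally show ?thesis .
  qed
  then have "exp_entropy \<mu> u \<le> (\<Sum>i\<in>I. (\<integral>x. exp (u x) * resample_var M i u x \<partial>\<mu>))"
    by (intro order_trans[OF entropy_subadditive[OF u]] sum_mono)
  also have "\<dots> = (\<integral>x. (\<Sum>i\<in>I. exp (u x) * resample_var M i u x) \<partial>\<mu>)"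
    by (rule Bochner_Integration.integral_sum[symmetric]) (intro integrable_bdd_meas bm)
  finally show ?thesis by (simp add: sum_distrib_left)
qed

section \<open>The Efron--Stein inequality and second order differences\<close>

text \<open>
  The variance telescopes along successive averaging, and each increment is \<open>\<integral>(v - P\<^sub>k v)\<^sup>2\<close>,
  where \<open>P\<^sub>k\<close> averages over the coordinate \<open>k\<close> and \<open>v\<close> is the conditional expectation of \<open>g\<close> so far. Since
  \<open>v - P\<^sub>k v\<close> depends on the remaining coordinates only, this integral equals
  \<open>\<integral>(v - P\<^sub>k v) (g - P\<^sub>k g)\<close>, hence is at most \<open>\<integral>(g - P\<^sub>k g)\<^sup>2\<close>.
\<close>

lemma efron_stein:
  assumes g: "bdd_meas \<mu> g" and "finite J" "J \<subseteq> I"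
  shows "\<exists>v. averages J g v \<and>
    (\<integral>x. (g x)\<^sup>2 \<partial>\<mu>) - (\<integral>x. (v x)\<^sup>2 \<partial>\<mu>) \<le> (\<Sum>j\<in>J. \<integral>x. (g x - avg M j g x)\<^sup>2 \<partial>\<mu>)"
  using assms(2,3)
proof (induction J rule: finite_induct)
  case empty
  show ?case by (rule exI[of _ g]) (auto simp: averages_def free_of_def intro!: bdd_meas_intros g)
next
  case (insert k J)
  then obtain v where av: "averages J g v"
    and le: "(\<integral>x. (g x)\<^sup>2 \<partial>\<mu>) - (\<integral>x. (v x)\<^sup>2 \<partial>\<mu>) \<le> (\<Sum>j\<in>J. \<integral>x. (g x - avg M j g x)\<^sup>2 \<partial>\<mu>)"
    by auto
  have v: "bdd_meas \<mu> v" "free_of J v" using av by (auto simp: averages_def)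
  have k: "k \<in> I" using insert by auto
  note bm = bdd_meas_intros bdd_meas_avg v g k
  let ?d = "\<lambda>u x. u x - avg M k u x"
  have d: "bdd_meas \<mu> (?d u)" if "bdd_meas \<mu> u" for u by (intro bm that)
  have dfree: "free_of J (?d v)"
    using v(2) free_of_mono[OF free_of_avg[OF v(2) k], of J] by (auto simp: free_of_def)
  have proj: "(\<integral>x. ?d u x * w x \<partial>\<mu>) = (\<integral>x. ?d u x * ?d w x \<partial>\<mu>)"
    if u: "bdd_meas \<mu> u" and w: "bdd_meas \<mu> w" for u w
  proof -
    have "(\<integral>x. ?d u x * avg M k w x \<partial>\<mu>) = (\<integral>x. u x * avg M k w x \<partial>\<mu>) - (\<integral>x. avg M k u x * avg M k w x \<partial>\<mu>)"
      unfolding left_diff_distrib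
      by (rule Bochner_Integration.integral_diff; intro integrable_bdd_meas bm u w)
    also have "(\<integral>x. u x * avg M k w x \<partial>\<mu>) = (\<integral>x. avg M k w x * u x \<partial>\<mu>)" by (simp add: mult.commute)
    also have "\<dots> = (\<integral>x. avg M k w x * avg M k u x \<partial>\<mu>)"
      using free_of_avg[of "{}" w k] k by (intro integral_mult_avg[symmetric] bm u w) (simp add: free_of_def)
    finally have "(\<integral>x. ?d u x * avg M k w x \<partial>\<mu>) = 0" by (simp add: mult.commute)
    moreover have "(\<integral>x. ?d u x * ?d w x \<partial>\<mu>) = (\<integral>x. ?d u x * w x \<partial>\<mu>) - (\<integral>x. ?d u x * avg M k w x \<partial>\<mu>)"
      unfolding right_diff_distrib[of "?d u _"]
      by (rule Bochner_Integration.integral_diff; intro integrable_bdd_meas bm u w)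
    ultimately show ?thesis by simp
  qed
  have "(\<integral>x. (?d v x)\<^sup>2 \<partial>\<mu>) = (\<integral>x. ?d v x * v x \<partial>\<mu>)"
    by (subst proj) (auto intro: v simp: power2_eq_square)
  also have "\<dots> = (\<integral>x. ?d v x * g x \<partial>\<mu>)"
    by (rule averagesD(1)[OF av d[OF v(1)] dfree, symmetric])
  also have "\<dots> = (\<integral>x. ?d v x * ?d g x \<partial>\<mu>)" by (rule proj; intro v g)
  also have "\<dots> \<le> (\<integral>x. 1 / 2 * (?d v x)\<^sup>2 + 1 / 2 * (?d g x)\<^sup>2 \<partial>\<mu>)"
  proof (rule integral_mono)
    have "a * b \<le> 1 / 2 * a\<^sup>2 + 1 / 2 * b\<^sup>2" for a b :: real
      using sum_squares_bound[of a b] by simp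
    then show "?d v x * ?d g x \<le> 1 / 2 * (?d v x)\<^sup>2 + 1 / 2 * (?d g x)\<^sup>2" for x .
  qed (intro integrable_bdd_meas bm)+
  also have "\<dots> = 1 / 2 * (\<integral>x. (?d v x)\<^sup>2 \<partial>\<mu>) + 1 / 2 * (\<integral>x. (?d g x)\<^sup>2 \<partial>\<mu>)"
    by (subst Bochner_Integration.integral_add) (auto intro!: integrable_bdd_meas bm)
  finally have 1: "(\<integral>x. (?d v x)\<^sup>2 \<partial>\<mu>) \<le> (\<integral>x. (?d g x)\<^sup>2 \<partial>\<mu>)" by simp
  have "(\<integral>x. (?d v x)\<^sup>2 \<partial>\<mu>) = (\<integral>x. ?d v x * v x \<partial>\<mu>)"
    by (subst proj) (auto intro: v simp: power2_eq_square)
  also have "\<dots> = (\<integral>x. v x * v x \<partial>\<mu>) - (\<integral>x. avg M k v x * v x \<partial>\<mu>)"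
    unfolding left_diff_distrib by (rule Bochner_Integration.integral_diff; intro integrable_bdd_meas bm)
  also have "(\<integral>x. avg M k v x * v x \<partial>\<mu>) = (\<integral>x. avg M k v x * avg M k v x \<partial>\<mu>)"
    using free_of_avg[of "{}" v k] k by (intro integral_mult_avg[symmetric] bm) (simp add: free_of_def)
  finally have 2: "(\<integral>x. (v x)\<^sup>2 \<partial>\<mu>) - (\<integral>x. (avg M k v x)\<^sup>2 \<partial>\<mu>) = (\<integral>x. (?d v x)\<^sup>2 \<partial>\<mu>)"
    by (simp add: power2_eq_square)
  show ?case using averages_insert[OF av k] 1 2 le insert
    by (intro exI[of _ "avg M k v"] conjI) simp_all
qed

lemma integral_resample_var:
  assumes u: "bdd_meas \<mu> u" and i: "i \<in> I"
  shows "(\<integral>x. resample_var M i u x \<partial>\<mu>) = (\<integral>x. (u x - avg M i u x)\<^sup>2 \<partial>\<mu>)"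
proof -
  have "(\<integral>x. resample_var M i u x \<partial>\<mu>) = (\<integral>x. avg M i (resample_var M i u) x \<partial>\<mu>)"
    by (rule integral_avg[symmetric]; intro integrable_bdd_meas bdd_meas_resample_var u i)
  also have "\<dots> = (\<integral>x. avg M i (\<lambda>x. (u x - avg M i u x)\<^sup>2) x \<partial>\<mu>)"
  proof (intro Bochner_Integration.integral_cong refl)
    fix x assume x: "x \<in> space \<mu>"
    show "avg M i (resample_var M i u) x = avg M i (\<lambda>x. (u x - avg M i u x)\<^sup>2) x"
      using M.half_square_difference[OF bdd_meas_slice[OF u i x]]
      by (simp add: avg_def resample_var_def)
  qed
  also have "\<dots> = (\<integral>x. (u x - avg M i u x)\<^sup>2 \<partial>\<mu>)"
    by (rule integral_avg; intro integrable_bdd_meas bdd_meas_intros bdd_meas_avg u i)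
  finally show ?thesis .
qed

lemma bdd_meas_mixed_var:
  assumes f: "bdd_meas \<mu> f" and i: "i \<in> I" and j: "j \<in> I"
  shows "bdd_meas \<mu> (mixed_var M i j f)"
  unfolding mixed_var_def[abs_def]
  by (intro bdd_meas_intros M.bdd_meas_integral bdd_meas_compose[OF f]
      measurable_fun_upd[where J = I] measurable_compose[OF measurable_fst] measurable_compose[OF measurable_snd])
    (use i j in auto)

text \<open>
  With \<open>w\<^sub>y x = f x - f (x(i := y))\<close>, the mixed second difference is the first difference of
  \<open>w\<^sub>y\<close> in the coordinate \<open>j\<close>. Integrating out \<open>j\<close> for fixed \<open>y\<close> replaces \<open>w\<^sub>y\<close> by
  \<open>w\<^sub>y - avg M j w\<^sub>y\<close>, which is the first difference of \<open>g\<close> in the coordinate \<open>i\<close>.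
\<close>

lemma integral_mixed_var:
  assumes f: "bdd_meas \<mu> f" and i: "i \<in> I" and j: "j \<in> I" and ij: "i \<noteq> j"
  defines "g \<equiv> \<lambda>x. f x - avg M j f x"
  shows "(\<integral>x. mixed_var M i j f x \<partial>\<mu>) = (\<integral>x. (g x - avg M i g x)\<^sup>2 \<partial>\<mu>)"
proof -
  have g: "bdd_meas \<mu> g" unfolding g_def by (intro bdd_meas_intros bdd_meas_avg f j)
  define w where "w = (\<lambda>y x. f x - f (x(i := y)))"
  have bw: "bdd_meas (\<mu> \<Otimes>\<^sub>M M i) (\<lambda>p. resample_var M j (w (snd p)) (fst p))"
    unfolding resample_var_def w_def
    by (intro bdd_meas_intros M.bdd_meas_integral bdd_meas_compose[OF f] 
        measurable_fun_upd[where J = I] measurable_compose[OF measurable_fst] measurable_compose[OF measurable_snd])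
      (use i j in auto)
  have w: "bdd_meas \<mu> (w y)" if "y \<in> space (M i)" for y
    unfolding w_def 
    by (intro bdd_meas_intros f bdd_meas_compose[OF f] measurable_fun_upd[where J = I] measurable_const that) (use i in auto)
  have mv: "mixed_var M i j f x = (\<integral>y. 1 / 2 * resample_var M j (w y) x \<partial>M i)" for x
    using ij by (simp add: mixed_var_def resample_var_def w_def fun_upd_twist[of i j] algebra_simps)
  have wavg: "w y x - avg M j (w y) x = g x - g (x(i := y))" if x: "x \<in> space \<mu>" and y: "y \<in> space (M i)" for x y
  proof -
    have "avg M j (w y) x = (\<integral>z. f (x(j := z)) - f (x(i := y, j := z)) \<partial>M j)"
      using ij by (simp add: avg_def w_def fun_upd_twist[of i j])
    also have "\<dots> = avg M j f x - avg M j f (x(i := y))"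
      unfolding avg_def
      by (rule Bochner_Integration.integral_diff; intro M.integrable_bdd_meas bdd_meas_slice f j x update_in_space[OF x i y])
    finally show ?thesis by (simp add: g_def w_def)
  qed
  have bg: "bdd_meas (\<mu> \<Otimes>\<^sub>M M i) (\<lambda>p. (g (fst p) - g ((fst p)(i := snd p)))\<^sup>2)"
    by (intro bdd_meas_intros g bdd_meas_update_pair i)
  have "(\<integral>x. mixed_var M i j f x \<partial>\<mu>) = (\<integral>y. \<integral>x. 1 / 2 * resample_var M j (w y) x \<partial>\<mu> \<partial>M i)"
    unfolding mv by (rule M.integral_swap) (intro P.prob_space_axioms bdd_meas_intros bw)+
  also have "\<dots> = (\<integral>y. \<integral>x. 1 / 2 * (g x - g (x(i := y)))\<^sup>2 \<partial>\<mu> \<partial>M i)"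
  proof (rule Bochner_Integration.integral_cong[OF refl])
    fix y assume y: "y \<in> space (M i)"
    have "(\<integral>x. resample_var M j (w y) x \<partial>\<mu>) = (\<integral>x. (w y x - avg M j (w y) x)\<^sup>2 \<partial>\<mu>)"
      by (rule integral_resample_var[OF w[OF y] j])
    also have "\<dots> = (\<integral>x. (g x - g (x(i := y)))\<^sup>2 \<partial>\<mu>)"
      by (intro Bochner_Integration.integral_cong refl) (simp add: wavg y)
    finally show "(\<integral>x. 1 / 2 * resample_var M j (w y) x \<partial>\<mu>) = (\<integral>x. 1 / 2 * (g x - g (x(i := y)))\<^sup>2 \<partial>\<mu>)"
      by simp
  qed
  also have "\<dots> = (\<integral>x. \<integral>y. 1 / 2 * (g x - g (x(i := y)))\<^sup>2 \<partial>M i \<partial>\<mu>)"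
    by (rule M.integral_swap[symmetric]) (intro P.prob_space_axioms bdd_meas_intros bg)+
  also have "\<dots> = (\<integral>x. resample_var M i g x \<partial>\<mu>)" by (simp add: resample_var_def)
  also have "\<dots> = (\<integral>x. (g x - avg M i g x)\<^sup>2 \<partial>\<mu>)" by (rule integral_resample_var[OF g i])
  finally show ?thesis .
qed

text \<open>
  This is the Efron--Stein inequality for \<open>g = f - avg M i f\<close> in the coordinates other than \<open>i\<close>. Its
  remainder is the second moment of the conditional expectation of \<open>g\<close> given the coordinate \<open>i\<close>,
  and it vanishes because \<open>f\<close> is orthogonal to all functions of that coordinate alone.
\<close>

lemma resample_var_le_mixed_var:
  assumes f: "bdd_meas \<mu> f" and i: "i \<in> I"
    and orth: "\<And>\<phi>. bdd_meas \<mu> \<phi> \<Longrightarrow> free_of (I - {i}) \<phi> \<Longrightarrow> (\<integral>x. \<phi> x * f x \<partial>\<mu>) = 0"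
  shows "(\<integral>x. resample_var M i f x \<partial>\<mu>) \<le> (\<Sum>j\<in>I - {i}. \<integral>x. mixed_var M j i f x \<partial>\<mu>)"
proof -
  define g where "g = (\<lambda>x. f x - avg M i f x)"
  have g: "bdd_meas \<mu> g" unfolding g_def by (intro bdd_meas_intros bdd_meas_avg f i)
  obtain v where av: "averages (I - {i}) g v"
    and le: "(\<integral>x. (g x)\<^sup>2 \<partial>\<mu>) - (\<integral>x. (v x)\<^sup>2 \<partial>\<mu>) \<le> (\<Sum>j\<in>I - {i}. \<integral>x. (g x - avg M j g x)\<^sup>2 \<partial>\<mu>)"
    using efron_stein[OF g, of "I - {i}"] finite_index by auto
  note v = averagesD(2,3)[OF av]
  have "(\<integral>x. (v x)\<^sup>2 \<partial>\<mu>) = (\<integral>x. v x * g x \<partial>\<mu>)"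
    using averagesD(1)[OF av v] by (simp add: power2_eq_square)
  also have "\<dots> = (\<integral>x. v x * f x \<partial>\<mu>) - (\<integral>x. v x * avg M i f x \<partial>\<mu>)"
    unfolding g_def right_diff_distrib
    by (rule Bochner_Integration.integral_diff; intro integrable_bdd_meas bdd_meas_intros bdd_meas_avg v f i)
  also have "(\<integral>x. v x * avg M i f x \<partial>\<mu>) = (\<integral>x. avg M i v x * f x \<partial>\<mu>)"
    by (rule avg_self_adjoint[OF i v(1) f])
  also have "\<dots> = 0"
    by (rule orth[OF bdd_meas_avg[OF v(1) i] free_of_mono[OF free_of_avg[OF v(2) i]]]) auto
  also have "(\<integral>x. v x * f x \<partial>\<mu>) = 0" by (rule orth[OF v])
  finally have v0: "(\<integral>x. (v x)\<^sup>2 \<partial>\<mu>) = 0" by simp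
  have "(\<integral>x. resample_var M i f x \<partial>\<mu>) = (\<integral>x. (g x)\<^sup>2 \<partial>\<mu>)"
    unfolding g_def by (rule integral_resample_var[OF f i])
  also have "\<dots> \<le> (\<Sum>j\<in>I - {i}. \<integral>x. (g x - avg M j g x)\<^sup>2 \<partial>\<mu>)" using le v0 by simp
  also have "\<dots> = (\<Sum>j\<in>I - {i}. \<integral>x. mixed_var M j i f x \<partial>\<mu>)"
    unfolding g_def by (intro sum.cong refl integral_mixed_var[symmetric] f i) auto
  finally show ?thesis .
qed

text \<open>
  Integrate over the coordinate \<open>j\<close> first: \<open>\<phi>\<close> does not see it and \<open>h\<close> integrates to zero. The
  kernel \<open>h\<close> is integrable but possibly unbounded, which is why integrability of the product is
  part of the conclusion.
\<close>

lemma kernel_orthogonal: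
  assumes S: "S \<subseteq> I" and h: "integrable (PiM S M) h" and j: "j \<in> S"
    and deg: "AE x in PiM S M. (\<integral>y. h (x(j := y)) \<partial>M j) = 0"
    and \<phi>: "bdd_meas \<mu> \<phi>" "free_of {j} \<phi>"
  shows "integrable \<mu> (\<lambda>x. \<phi> x * h (restrict x S))"
    and "(\<integral>x. \<phi> x * h (restrict x S) \<partial>\<mu>) = 0"
proof -
  let ?R = "\<lambda>x. restrict x S"
  have R: "?R \<in> measurable \<mu> (PiM S M)" by (rule measurable_restrict_subset[OF S])
  have d: "distr \<mu> (PiM S M) ?R = PiM S M"
    using distr_restrict[OF S] finite_index by simp
  have int: "integrable \<mu> (\<lambda>x. h (?R x))"
    using integrable_distr[OF R, of h] h by (simp add: d)
  obtain C where C: "\<And>x. x \<in> space \<mu> \<Longrightarrow> \<bar>\<phi> x\<bar> \<le> C" using bdd_meas_bound[OF \<phi>(1)] by blast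
  note [measurable] = bdd_meas_measurable[OF \<phi>(1)] borel_measurable_integrable[OF int]
  show int\<phi>: "integrable \<mu> (\<lambda>x. \<phi> x * h (?R x))"
  proof (rule Bochner_Integration.integrable_bound)
    show "integrable \<mu> (\<lambda>x. C * h (?R x))" using int by simp
    show "AE x in \<mu>. norm (\<phi> x * h (?R x)) \<le> norm (C * h (?R x))"
      by (rule AE_I2) (auto simp: abs_mult intro!: mult_right_mono order_trans[OF C])
  qed simp
  have ji: "j \<in> I" using j S by auto
  have ae: "AE x in \<mu>. (\<integral>y. h ((?R x)(j := y)) \<partial>M j) = 0"
    by (rule AE_distrD[OF R, unfolded d, OF deg])
  have upd: "?R (x(j := y)) = (?R x)(j := y)" for x y
    using j by (auto simp: restrict_def)
  have "(\<integral>x. \<phi> x * h (?R x) \<partial>\<mu>) = (\<integral>x. avg M j (\<lambda>x. \<phi> x * h (?R x)) x \<partial>\<mu>)"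
    by (rule integral_avg[OF ji int\<phi>, symmetric])
  also have "\<dots> = (\<integral>x. \<phi> x * (\<integral>y. h ((?R x)(j := y)) \<partial>M j) \<partial>\<mu>)"
    by (intro Bochner_Integration.integral_cong refl)
      (simp add: avg_mult_free[OF \<phi>(2)], simp add: avg_def upd)
  also have "\<dots> = 0"
    by (rule integral_eq_zero_AE) (use ae in \<open>auto elim: eventually_mono\<close>)
  finally show "(\<integral>x. \<phi> x * h (?R x) \<partial>\<mu>) = 0" .
qed

section \<open>Exponential moments on product spaces\<close>

lemma resample_var_cmult: "resample_var M i (\<lambda>x. t * g x) x = t\<^sup>2 * resample_var M i g x"
  by (simp add: resample_var_def right_diff_distrib[symmetric] power_mult_distrib)

lemma resample_var_nonneg: "0 \<le> resample_var M i g x"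
  by (auto simp: resample_var_def)

text \<open>
  The modified logarithmic Sobolev inequality feeds the Herbst argument with \<open>\<kappa> = 1\<close>. The lemma
  \<open>subgaussian\<close> removes the sign condition on \<open>t\<close> by passing to \<open>-g\<close>.
\<close>

lemma subgaussian_pos:
  assumes g: "bdd_meas \<mu> g" and le: "\<And>x. x \<in> space \<mu> \<Longrightarrow> (\<Sum>i\<in>I. resample_var M i g x) \<le> 1"
    and t: "t > 0"
  shows "(\<integral>x. exp (t * g x) \<partial>\<mu>) \<le> exp (t * (\<integral>x. g x \<partial>\<mu>) + t\<^sup>2)"
proof -
  note bm = integrable_bdd_meas bdd_meas_intros g bdd_meas_resample_var
  have "ln (\<integral>x. exp (t * g x) \<partial>\<mu>) \<le> t * (\<integral>x. g x \<partial>\<mu>) + 1 * t\<^sup>2"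
  proof (rule herbst[OF g t])
    fix s :: real assume s: "0 < s"
    have "exp_entropy \<mu> (\<lambda>x. s * g x) \<le> (\<integral>x. exp (s * g x) * (\<Sum>i\<in>I. resample_var M i (\<lambda>x. s * g x) x) \<partial>\<mu>)"
      by (rule modified_log_sobolev; intro bm)
    also have "\<dots> \<le> (\<integral>x. exp (s * g x) * s\<^sup>2 \<partial>\<mu>)"
    proof (rule integral_mono)
      fix x assume "x \<in> space \<mu>"
      then have "s\<^sup>2 * (\<Sum>i\<in>I. resample_var M i g x) \<le> s\<^sup>2 * 1" by (intro mult_left_mono le) auto
      then show "exp (s * g x) * (\<Sum>i\<in>I. resample_var M i (\<lambda>x. s * g x) x) \<le> exp (s * g x) * s\<^sup>2"
        by (intro mult_left_mono) (auto simp: resample_var_cmult sum_distrib_left)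
    qed (intro bm; assumption)+
    finally show "exp_entropy \<mu> (\<lambda>x. s * g x) \<le> 1 * s\<^sup>2 * (\<integral>x. exp (s * g x) \<partial>\<mu>)" by (simp add: mult.commute)
  qed
  moreover have "0 < (\<integral>x. exp (t * g x) \<partial>\<mu>)" by (intro integral_exp_pos bm)
  ultimately show ?thesis by (intro le_exp_if_ln_le) simp_all
qed

lemma subgaussian:
  assumes g: "bdd_meas \<mu> g" and le: "\<And>x. x \<in> space \<mu> \<Longrightarrow> (\<Sum>i\<in>I. resample_var M i g x) \<le> 1"
  shows "(\<integral>x. exp (t * g x) \<partial>\<mu>) \<le> exp (t * (\<integral>x. g x \<partial>\<mu>) + t\<^sup>2)"
proof -
  consider "t > 0" | "t = 0" | "t < 0" by linarith
  then show ?thesis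
  proof cases
    case 1
    then show ?thesis by (intro subgaussian_pos g le)
  next
    case 2
    then show ?thesis by (simp add: P.prob_space)
  next
    case 3
    have "(\<integral>x. exp (- t * (- g x)) \<partial>\<mu>) \<le> exp (- t * (\<integral>x. - g x \<partial>\<mu>) + (- t)\<^sup>2)"
    proof (rule subgaussian_pos)
      show "(\<Sum>i\<in>I. resample_var M i (\<lambda>x. - g x) x) \<le> 1" if "x \<in> space \<mu>" for x
        using le[OF that] resample_var_cmult[of _ "-1" g] by simp
    qed (use 3 in \<open>auto intro!: bdd_meas_intros g\<close>)
    then show ?thesis by simp
  qed
qed

text \<open>
  Let \<open>\<Gamma>\<close> be the squared gradient of \<open>f\<close> and \<open>Z = \<integral>e\<^bsup>tf\<^esup>\<close>. The modified logarithmic Sobolev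
  inequality bounds the entropy of \<open>e\<^bsup>tf\<^esup>\<close> by \<open>t\<^sup>2 \<integral>\<Gamma> e\<^bsup>tf\<^esup>\<close>, and the duality formula bounds
  \<open>s \<integral>\<Gamma> e\<^bsup>tf\<^esup>\<close> by that entropy plus \<open>\<beta> Z\<close>. For \<open>t\<^sup>2 < s\<close> the entropy can be absorbed on the left, which
  leaves the hypothesis of the Herbst argument with \<open>\<kappa> = \<beta> / (s - T\<^sup>2)\<close>.
\<close>

lemma exp_moment_of_gradient_moment:
  assumes f: "bdd_meas \<mu> f" and mean: "(\<integral>x. f x \<partial>\<mu>) = 0"
    and T: "0 < T" "T\<^sup>2 < s"
    and \<beta>: "(\<integral>x. exp (s * (\<Sum>i\<in>I. resample_var M i f x)) \<partial>\<mu>) \<le> exp \<beta>"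
  shows "(\<integral>x. exp (T * f x) \<partial>\<mu>) \<le> exp (T\<^sup>2 * \<beta> / (s - T\<^sup>2))"
proof -
  define \<Gamma> where "\<Gamma> = (\<lambda>x. \<Sum>i\<in>I. resample_var M i f x)"
  have \<Gamma>: "bdd_meas \<mu> \<Gamma>" unfolding \<Gamma>_def by (intro bdd_meas_intros bdd_meas_resample_var f)
  have \<Gamma>_nonneg: "0 \<le> \<Gamma> x" for x unfolding \<Gamma>_def by (intro sum_nonneg resample_var_nonneg)
  note bm = integrable_bdd_meas bdd_meas_intros f \<Gamma>
  have s: "s > 0" using T by (meson le_less_trans zero_le_power2)
  let ?W = "\<integral>x. exp (s * \<Gamma> x) \<partial>\<mu>"
  have W: "0 < ?W" by (intro integral_exp_pos bm)
  have \<beta>': "ln ?W \<le> \<beta>" 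
    using \<beta> W ln_le_cancel_iff[of ?W "exp \<beta>"] by (simp add: \<Gamma>_def)
  have "(\<integral>x. 1 \<partial>\<mu>) \<le> ?W"
    by (rule integral_mono, (intro bm)+) (use s \<Gamma>_nonneg in auto)
  then have "0 \<le> ln ?W" by (intro ln_ge_zero) (simp add: P.prob_space)
  then have \<beta>0: "0 \<le> \<beta>" using \<beta>' by linarith
  have "ln (\<integral>x. exp (T * f x) \<partial>\<mu>) \<le> T * (\<integral>x. f x \<partial>\<mu>) + \<beta> / (s - T\<^sup>2) * T\<^sup>2"
  proof (rule herbst[OF f T(1)])
    fix t :: real assume t: "0 < t" "t \<le> T"
    let ?E = "exp_entropy \<mu> (\<lambda>x. t * f x)" and ?Z = "\<integral>x. exp (t * f x) \<partial>\<mu>"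
    have Z: "0 < ?Z" by (intro integral_exp_pos bm)
    have tT: "t\<^sup>2 \<le> T\<^sup>2" using t by (intro power_mono) auto
    have "?E \<le> (\<integral>x. exp (t * f x) * (\<Sum>i\<in>I. resample_var M i (\<lambda>x. t * f x) x) \<partial>\<mu>)"
      by (rule modified_log_sobolev; intro bm)
    also have "\<dots> = t\<^sup>2 * (\<integral>x. exp (t * f x) * \<Gamma> x \<partial>\<mu>)"
      by (simp add: resample_var_cmult \<Gamma>_def mult.left_commute flip: sum_distrib_left)
    finally have 1: "?E \<le> t\<^sup>2 * (\<integral>x. exp (t * f x) * \<Gamma> x \<partial>\<mu>)" .
    have "s * (\<integral>x. exp (t * f x) * \<Gamma> x \<partial>\<mu>) = (\<integral>x. exp (t * f x) * (s * \<Gamma> x) \<partial>\<mu>)"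
      by (simp add: mult.left_commute)
    also have "\<dots> \<le> ?E + ?Z * ln ?W" by (rule entropy_duality; intro bm)
    also have "\<dots> \<le> ?E + ?Z * \<beta>" using \<beta>' Z by simp
    finally have 2: "t\<^sup>2 * (s * (\<integral>x. exp (t * f x) * \<Gamma> x \<partial>\<mu>)) \<le> t\<^sup>2 * (?E + ?Z * \<beta>)" by (intro mult_left_mono) auto
    have "s * ?E \<le> s * (t\<^sup>2 * (\<integral>x. exp (t * f x) * \<Gamma> x \<partial>\<mu>))" using 1 s by (intro mult_left_mono) auto
    then have "(s - t\<^sup>2) * ?E \<le> t\<^sup>2 * ?Z * \<beta>" using 2 by (simp add: algebra_simps)
    then have "?E \<le> t\<^sup>2 * ?Z * \<beta> / (s - t\<^sup>2)" using T tT by (simp add: pos_le_divide_eq mult.commute)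
    also have "\<dots> \<le> t\<^sup>2 * ?Z * \<beta> / (s - T\<^sup>2)" using T tT Z \<beta>0 by (intro divide_left_mono) auto
    finally show "?E \<le> \<beta> / (s - T\<^sup>2) * t\<^sup>2 * ?Z" by (simp add: mult_ac)
  qed
  moreover have "0 < (\<integral>x. exp (T * f x) \<partial>\<mu>)" by (intro integral_exp_pos bm)
  ultimately show ?thesis by (intro le_exp_if_ln_le) (simp_all add: mean mult.commute)
qed

text \<open>
  The constant \<open>4/25\<close> below is chosen such that \<open>1 - 4 \<cdot> 4/25 = (3/5)\<^sup>2\<close>: then \<open>exp_square_moment\<close> for
  the length \<open>g\<close> of the gradient reads \<open>\<integral>exp (4/25 g\<^sup>2) \<le> 5/3 exp (4/9 (\<integral>g)\<^sup>2)\<close>. The two signs of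
  \<open>f\<close> contribute \<open>sqrt 2\<close> each to the exponential moment of \<open>\<bar>f\<bar>\<close> at \<open>T\<close>.
\<close>

theorem exp_moment_le_two:
  assumes I: "I \<noteq> {}" and f: "bdd_meas \<mu> f"
    and orth: "\<And>i \<phi>. i \<in> I \<Longrightarrow> bdd_meas \<mu> \<phi> \<Longrightarrow> free_of (I - {i}) \<phi> \<Longrightarrow> (\<integral>x. \<phi> x * f x \<partial>\<mu>) = 0"
    and grad: "\<And>x. x \<in> space \<mu> \<Longrightarrow>
      (\<Sum>j\<in>I. resample_var M j (\<lambda>x. sqrt (\<Sum>i\<in>I. resample_var M i f x)) x) \<le> 1"
    and hess: "(\<Sum>i\<in>I. \<Sum>j\<in>I - {i}. \<integral>x. mixed_var M j i f x \<partial>\<mu>) \<le> B"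
  shows "(\<integral>x. exp (1 / (2 * (3 + B)) * \<bar>f x\<bar>) \<partial>\<mu>) \<le> 2"
proof -
  define \<Gamma> where "\<Gamma> = (\<lambda>x. \<Sum>i\<in>I. resample_var M i f x)"
  define g where "g = (\<lambda>x. sqrt (\<Gamma> x))"
  define m where "m = (\<integral>x. g x \<partial>\<mu>)"
  have \<Gamma>: "bdd_meas \<mu> \<Gamma>" unfolding \<Gamma>_def by (intro bdd_meas_intros bdd_meas_resample_var f)
  have \<Gamma>_nonneg: "0 \<le> \<Gamma> x" for x unfolding \<Gamma>_def by (intro sum_nonneg resample_var_nonneg)
  have g: "bdd_meas \<mu> g" unfolding g_def by (intro bdd_meas_intros \<Gamma>)
  have g2: "(g x)\<^sup>2 = \<Gamma> x" for x by (simp add: g_def \<Gamma>_nonneg)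
  note bm = integrable_bdd_meas bdd_meas_intros f \<Gamma> g bdd_meas_resample_var
  obtain i0 where i0: "i0 \<in> I" using I by auto
  have mean: "(\<integral>x. f x \<partial>\<mu>) = 0"
    using orth[OF i0 bdd_meas_const[of _ 1]] by (simp add: free_of_def)
  have "(\<integral>x. \<Gamma> x \<partial>\<mu>) = (\<Sum>i\<in>I. \<integral>x. resample_var M i f x \<partial>\<mu>)"
    unfolding \<Gamma>_def by (rule Bochner_Integration.integral_sum; intro bm)
  also have "\<dots> \<le> (\<Sum>i\<in>I. \<Sum>j\<in>I - {i}. \<integral>x. mixed_var M j i f x \<partial>\<mu>)"
    by (intro sum_mono resample_var_le_mixed_var f orth)
  also note hess
  finally have E\<Gamma>: "(\<integral>x. \<Gamma> x \<partial>\<mu>) \<le> B" .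
  have "0 \<le> (\<integral>x. \<Gamma> x \<partial>\<mu>)" by (intro Bochner_Integration.integral_nonneg \<Gamma>_nonneg)
  then have B: "B \<ge> 0" using E\<Gamma> by simp
  \<comment> \<open>the mean of \<open>g\<close> is controlled by its second moment, which is the energy of \<open>f\<close>\<close>
  have "0 \<le> (\<integral>x. (g x - m)\<^sup>2 \<partial>\<mu>)" by (intro Bochner_Integration.integral_nonneg) simp
  also have "\<dots> = (\<integral>x. (\<Gamma> x - 2 * m * g x) + m\<^sup>2 \<partial>\<mu>)"
    by (simp add: power2_diff g2 mult_ac diff_add_eq)
  also have "\<dots> = (\<integral>x. \<Gamma> x - 2 * m * g x \<partial>\<mu>) + m\<^sup>2"
    by (subst Bochner_Integration.integral_add, (intro bm)+) (simp add: P.prob_space)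
  also have "(\<integral>x. \<Gamma> x - 2 * m * g x \<partial>\<mu>) = (\<integral>x. \<Gamma> x \<partial>\<mu>) - 2 * m * m"
    by (subst Bochner_Integration.integral_diff, (intro bm)+) (simp add: m_def)
  finally have m2: "m\<^sup>2 \<le> B" using E\<Gamma> by (simp add: power2_eq_square)
  have "(\<integral>x. exp (4 / 25 * (g x)\<^sup>2) \<partial>\<mu>) \<le> 1 / sqrt (1 - 4 * (4 / 25)) * exp (4 / 25 * m\<^sup>2 / (1 - 4 * (4 / 25)))"
    unfolding m_def
    by (rule exp_square_moment[OF g _ _ subgaussian[OF g]]) (use grad in \<open>auto simp: g_def \<Gamma>_def\<close>)
  also have "\<dots> = 5 / 3 * exp (4 / 9 * m\<^sup>2)"
  proof -
    have "sqrt (9 / 25) = sqrt ((3 / 5)\<^sup>2)" by (simp add: power_divide)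
    then have "sqrt (9 / 25) = (3 / 5 :: real)" by simp
    then show ?thesis by (simp add: field_simps)
  qed
  also have "\<dots> \<le> 5 / 3 * exp (4 / 9 * B)" using m2 by simp
  also have "\<dots> = exp (ln (5 / 3) + 4 / 9 * B)" by (simp add: exp_add)
  finally have E\<beta>: "(\<integral>x. exp (4 / 25 * \<Gamma> x) \<partial>\<mu>) \<le> exp (ln (5 / 3) + 4 / 9 * B)" by (simp add: g2)
  define T where "T = 3 / (4 * (3 + B))"
  have T: "0 < T" using B by (simp add: T_def)
  note num = exponent_numerics[OF B, folded T_def]
  have one_sided: "(\<integral>x. exp (T * h x) \<partial>\<mu>) \<le> sqrt 2"
    if h: "bdd_meas \<mu> h" "(\<integral>x. h x \<partial>\<mu>) = 0" "\<And>x. (\<Sum>i\<in>I. resample_var M i h x) = \<Gamma> x" for h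
  proof -
    have "(\<integral>x. exp (T * h x) \<partial>\<mu>) \<le> exp (T\<^sup>2 * (ln (5 / 3) + 4 / 9 * B) / (4 / 25 - T\<^sup>2))"
      by (rule exp_moment_of_gradient_moment[OF h(1,2) T num(1)]) (simp only: h(3) E\<beta>)
    also have "\<dots> \<le> exp (ln 2 / 2)" using num(2) by simp
    also have "\<dots> = sqrt 2" by (simp flip: ln_sqrt)
    finally show ?thesis .
  qed
  have "(\<integral>x. exp (T * \<bar>f x\<bar>) \<partial>\<mu>) \<le> (\<integral>x. exp (T * f x) + exp (T * (- f x)) \<partial>\<mu>)"
    by (rule integral_mono, (intro bm)+) (auto simp: abs_if)
  also have "\<dots> = (\<integral>x. exp (T * f x) \<partial>\<mu>) + (\<integral>x. exp (T * (- f x)) \<partial>\<mu>)"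
    by (rule Bochner_Integration.integral_add; intro bm)
  also have "\<dots> \<le> sqrt 2 + sqrt 2"
  proof (rule add_mono)
    show "(\<integral>x. exp (T * f x) \<partial>\<mu>) \<le> sqrt 2" by (rule one_sided[OF f mean]) (simp add: \<Gamma>_def)
    show "(\<integral>x. exp (T * (- f x)) \<partial>\<mu>) \<le> sqrt 2"
      using resample_var_cmult[of _ "-1" f] by (intro one_sided) (auto intro!: bm simp: \<Gamma>_def mean)
  qed
  finally have "(\<integral>x. exp (2 / 3 * T * \<bar>f x\<bar>) \<partial>\<mu>) \<le> 2"
    by (intro two_thirds_moment_le_two f) simp
  moreover have "1 / (2 * (3 + B)) = 2 / 3 * T" using B by (simp add: T_def field_simps)
  ultimately show ?thesis by (simp only:)
qed

end

section \<open>From the Hoeffding decomposition to the estimate\<close>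

text \<open>
  Every kernel of degree at least two has a variable other than \<open>x\<^sub>i\<close>, so it is orthogonal to
  functions of \<open>x\<^sub>i\<close> alone. The Hoeffding terms \<open>F k\<close> need not be measurable; the integrals are
  therefore taken of the sums of kernels \<open>G k\<close> that represent them almost everywhere.
\<close>

lemma hoeffding_orthogonal:
  assumes P: "finite_product_prob_space M {1..n}"
    and f: "bdd_meas (PiM {1..n} M) f"
    and dec: "hoeffding_decomposition n M f F"
    and F0: "AE x in PiM {1..n} M. F 0 x = 0"
    and F1: "AE x in PiM {1..n} M. F 1 x = 0"
    and i: "i \<in> {1..n}"
    and \<phi>: "bdd_meas (PiM {1..n} M) \<phi>" "finite_product_prob_space.free_of M {1..n} ({1..n} - {i}) \<phi>"
  shows "(\<integral>x. \<phi> x * f x \<partial>PiM {1..n} M) = 0"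
proof -
  interpret finite_product_prob_space M "{1..n}" by (rule P)
  have \<phi>': "free_of {j} \<phi>" if "j \<in> {1..n}" "j \<noteq> i" for j
    by (rule free_of_mono[OF \<phi>(2)]) (use that in auto)
  have part: "\<exists>G. (AE x in \<mu>. \<phi> x * F k x = G x) \<and> integrable \<mu> G \<and> (\<integral>x. G x \<partial>\<mu>) = 0"
    if k: "k \<in> {2..n}" for k
  proof -
    have k1: "k \<in> {1..n}" using k by simp
    obtain h where h: "\<forall>S. S \<subseteq> {1..n} \<and> card S = k \<longrightarrow> hoeffding_kernel M S (h S)"
      and Fk: "AE x in \<mu>. F k x = (\<Sum>S | S \<subseteq> {1..n} \<and> card S = k. h S (restrict x S))"
      using bspec[OF conjunct2[OF conjunct2[OF dec[unfolded hoeffding_decomposition_def]]] k1] by (elim exE conjE)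
    have *: "integrable \<mu> (\<lambda>x. \<phi> x * h S (restrict x S)) \<and> (\<integral>x. \<phi> x * h S (restrict x S) \<partial>\<mu>) = 0"
      if S: "S \<subseteq> {1..n}" "card S = k" for S
    proof -
      have "\<not> S \<subseteq> {i}" using S k card_mono[of "{i}" S] by auto
      then obtain j where j: "j \<in> S" "j \<noteq> i" by auto
      have "j \<in> {1..n}" using j S by auto
      note \<phi>j = \<phi>'[OF this j(2)]
      have "hoeffding_kernel M S (h S)" using h S by blast
      then have "integrable (PiM S M) (h S)" "AE x in PiM S M. (\<integral>y. h S (x(j := y)) \<partial>M j) = 0"
        using j(1) unfolding hoeffding_kernel_def by blast+
      then show ?thesis
        using kernel_orthogonal[OF S(1) _ j(1) _ \<phi>(1) \<phi>j] by blast
    qed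
    define G where "G = (\<lambda>x. \<Sum>S | S \<subseteq> {1..n} \<and> card S = k. \<phi> x * h S (restrict x S))"
    have "integrable \<mu> G" "(\<integral>x. G x \<partial>\<mu>) = 0"
      unfolding G_def using * by (auto simp: Bochner_Integration.integral_sum)
    moreover have "AE x in \<mu>. \<phi> x * F k x = G x"
      using Fk by eventually_elim (simp add: G_def sum_distrib_left)
    ultimately show ?thesis by blast
  qed
  then obtain G where G: "\<And>k. k \<in> {2..n} \<Longrightarrow> AE x in \<mu>. \<phi> x * F k x = G k x"
    "\<And>k. k \<in> {2..n} \<Longrightarrow> integrable \<mu> (G k)" "\<And>k. k \<in> {2..n} \<Longrightarrow> (\<integral>x. G k x \<partial>\<mu>) = 0"
    by metis
  have "AE x in \<mu>. \<forall>k\<in>{2..n}. \<phi> x * F k x = G k x"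
    by (rule AE_finite_allI) (auto intro: G(1))
  moreover have "AE x in \<mu>. f x = (\<Sum>k = 0..n. F k x)"
    using dec by (simp add: hoeffding_decomposition_def)
  ultimately have "AE x in \<mu>. \<phi> x * f x = (\<Sum>k = 2..n. G k x)"
    using F0 F1
  proof eventually_elim
    case (elim x)
    have "(\<Sum>k = 0..n. F k x) = (\<Sum>k = 2..n. F k x)"
      by (rule sum.mono_neutral_right) (use elim in \<open>auto simp: not_le less_2_cases_iff\<close>)
    then have "\<phi> x * f x = (\<Sum>k = 2..n. \<phi> x * F k x)"
      using elim by (simp add: sum_distrib_left)
    then show ?case using elim by simp
  qed
  then have "(\<integral>x. \<phi> x * f x \<partial>\<mu>) = (\<integral>x. (\<Sum>k = 2..n. G k x) \<partial>\<mu>)"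
    using f \<phi>(1) G(2)
    by (intro integral_cong_AE borel_measurable_times borel_measurable_sum) 
      (auto intro: bdd_meas_measurable borel_measurable_integrable)
  also have "\<dots> = 0" using G(2,3) by (simp add: Bochner_Integration.integral_sum)
  finally show ?thesis .
qed

theorem theorem1p2:
  fixes n :: nat
    and M :: "nat \<Rightarrow> 'a measure"
    and f :: "(nat \<Rightarrow> 'a) \<Rightarrow> real"
    and F :: "nat \<Rightarrow> (nat \<Rightarrow> 'a) \<Rightarrow> real"
    and b :: real
  assumes "n \<ge> 1"
    and "\<And>i. i \<in> {1..n} \<Longrightarrow> prob_space (M i)"
    and "f \<in> borel_measurable (PiM {1..n} M)"
    and "bounded (f ` space (PiM {1..n} M))"
    and "hoeffding_decomposition n M f F"
    and "AE x in PiM {1..n} M. F 0 x = 0"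
    and "AE x in PiM {1..n} M. F 1 x = 0"
    and "\<And>x. x \<in> space (PiM {1..n} M) \<Longrightarrow> diff_norm n M (diff_norm n M f) x \<le> 1"
    and "b \<ge> 0"
    and "(\<integral>x. (hs_norm n (diff2_matrix M f x))\<^sup>2 \<partial>PiM {1..n} M) \<le> b\<^sup>2"
  shows "(\<integral>x. exp (1 / (2 * (3 + b\<^sup>2)) * \<bar>f x\<bar>) \<partial>PiM {1..n} M) \<le> 2"
proof -
  \<comment> \<open>the product space locale wants a probability measure at every index\<close>
  define M' where "M' = (\<lambda>i. if i \<in> {1..n} then M i else M 1)"
  have M': "M' i = M i" if "i \<in> {1..n}" for i using that by (simp add: M'_def)
  have PM: "PiM S M' = PiM S M" if "S \<subseteq> {1..n}" for S
    using that M' by (intro PiM_cong) auto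
  have prob: "prob_space (M' i)" for i
    using assms(1,2) by (simp add: M'_def)
  have fin: "finite_product_prob_space M' {1..n}"
    unfolding finite_product_prob_space_def finite_product_sigma_finite_def
      finite_product_sigma_finite_axioms_def
    using product_prob_spaceI[OF prob] by (simp add: product_prob_space_def)
  interpret finite_product_prob_space M' "{1..n}" by (rule fin)
  have mu: "\<mu> = PiM {1..n} M" by (rule PM) simp
  have f: "bdd_meas \<mu> f"
    using assms(3,4) unfolding mu bdd_meas_def bounded_iff by auto
  have kernel: "hoeffding_kernel M' S h \<longleftrightarrow> hoeffding_kernel M S h" if "S \<subseteq> {1..n}" for S h
    unfolding hoeffding_kernel_def PM[OF that]
    by (intro conj_cong refl ball_cong) (use that M' in auto)
  have kernels: "(\<forall>S. S \<subseteq> {1..n} \<and> card S = k \<longrightarrow> hoeffding_kernel M' S (h S)) \<longleftrightarrow>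
      (\<forall>S. S \<subseteq> {1..n} \<and> card S = k \<longrightarrow> hoeffding_kernel M S (h S))" for k h
    using kernel by blast
  have dec: "hoeffding_decomposition n M' f F"
    using assms(5) unfolding hoeffding_decomposition_def mu kernels .
  have op: "diff_op M i h x = sqrt (resample_var M' i h x)" if "i \<in> {1..n}" for i h x
    using M'[OF that] by (simp add: diff_op_def resample_var_def)
  have op2: "diff2_op M i j h x = sqrt (mixed_var M' i j h x)" if "i \<in> {1..n}" "j \<in> {1..n}" for i j h x
    using M'[OF that(1)] M'[OF that(2)] by (simp add: diff2_op_def mixed_var_def)
  have mixed_nonneg: "0 \<le> mixed_var M' i j h x" for i j h x
    by (auto simp: mixed_var_def)
  have norm: "diff_norm n M h x = sqrt (\<Sum>i\<in>{1..n}. resample_var M' i h x)" for h x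
    unfolding diff_norm_def L2_set_def by (intro arg_cong[where f = sqrt] sum.cong) (auto simp: op resample_var_nonneg)
  have hs: "(hs_norm n (diff2_matrix M f x))\<^sup>2 = (\<Sum>i\<in>{1..n}. \<Sum>j\<in>{1..n} - {i}. mixed_var M' j i f x)" for x
  proof -
    have "(hs_norm n (diff2_matrix M f x))\<^sup>2 = (\<Sum>j = 1..n. \<Sum>i = 1..n. (diff2_matrix M f x j i)\<^sup>2)"
      unfolding hs_norm_def by (simp add: sum_nonneg)
    also have "\<dots> = (\<Sum>i = 1..n. \<Sum>j = 1..n. (diff2_matrix M f x j i)\<^sup>2)" by (rule sum.swap)
    also have "\<dots> = (\<Sum>i\<in>{1..n}. \<Sum>j\<in>{1..n} - {i}. mixed_var M' j i f x)"
    proof (rule sum.cong[OF refl])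
      fix i assume i: "i \<in> {1..n}"
      have "(\<Sum>j = 1..n. (diff2_matrix M f x j i)\<^sup>2) = (\<Sum>j\<in>{1..n} - {i}. (diff2_matrix M f x j i)\<^sup>2)"
        by (rule sum.mono_neutral_right) (auto simp: diff2_matrix_def)
      also have "\<dots> = (\<Sum>j\<in>{1..n} - {i}. mixed_var M' j i f x)"
        using i by (intro sum.cong refl) (auto simp: diff2_matrix_def op2 mixed_nonneg)
      finally show "(\<Sum>j = 1..n. (diff2_matrix M f x j i)\<^sup>2) = (\<Sum>j\<in>{1..n} - {i}. mixed_var M' j i f x)" .
    qed
    finally show ?thesis .
  qed
  have "(\<integral>x. exp (1 / (2 * (3 + b\<^sup>2)) * \<bar>f x\<bar>) \<partial>\<mu>) \<le> 2"
  proof (rule exp_moment_le_two[OF _ f])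
    show "{1..n} \<noteq> {}" using assms(1) by simp
    show "(\<integral>x. \<phi> x * f x \<partial>\<mu>) = 0"
      if "i \<in> {1..n}" "bdd_meas \<mu> \<phi>" "free_of ({1..n} - {i}) \<phi>" for i \<phi>
      by (rule hoeffding_orthogonal[OF fin f dec _ _ that]) (use assms(6,7) in \<open>simp_all only: mu\<close>)
    show "(\<Sum>j\<in>{1..n}. resample_var M' j (\<lambda>x. sqrt (\<Sum>i\<in>{1..n}. resample_var M' i f x)) x) \<le> 1"
      if "x \<in> space \<mu>" for x
      using assms(8)[of x] that unfolding mu norm[abs_def] by simp
    have bm: "bdd_meas \<mu> (mixed_var M' j i f)" if "i \<in> {1..n}" "j \<in> {1..n} - {i}" for i j
      using that by (intro bdd_meas_mixed_var f) auto
    have "(\<integral>x. (\<Sum>i\<in>{1..n}. \<Sum>j\<in>{1..n} - {i}. mixed_var M' j i f x) \<partial>\<mu>) =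
       (\<Sum>i\<in>{1..n}. \<integral>x. (\<Sum>j\<in>{1..n} - {i}. mixed_var M' j i f x) \<partial>\<mu>)"
      by (intro Bochner_Integration.integral_sum integrable_bdd_meas bdd_meas_sum bm)
    also have "\<dots> = (\<Sum>i\<in>{1..n}. \<Sum>j\<in>{1..n} - {i}. \<integral>x. mixed_var M' j i f x \<partial>\<mu>)"
      by (intro sum.cong refl Bochner_Integration.integral_sum integrable_bdd_meas bm)
    finally have "(\<integral>x. (\<Sum>i\<in>{1..n}. \<Sum>j\<in>{1..n} - {i}. mixed_var M' j i f x) \<partial>\<mu>) =
       (\<Sum>i\<in>{1..n}. \<Sum>j\<in>{1..n} - {i}. \<integral>x. mixed_var M' j i f x \<partial>\<mu>)" .
    then show "(\<Sum>i\<in>{1..n}. \<Sum>j\<in>{1..n} - {i}. \<integral>x. mixed_var M' j i f x \<partial>\<mu>) \<le> b\<^sup>2"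
      using assms(10) unfolding mu hs by simp
  qed
  then show ?thesis by (simp only: mu)
qed

end
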